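(* Let $G$ be a self-similar group over a finite alphabet $X$ and $K$ a field, and let $S$ be the associated inverse semigroup. The kernel of the representation of $K_0S$ on $KX^\omega$ is the singular ideal $I_K(S)$. Consequently, the kernel of the action of the Nekrashevych algebra $\mathcal N_K(G,X)$ on $KX^\omega$ is $I_K(S)/\mathcal T_K(S)$. Therefore $\mathcal N_K(G,X)$ is simple if and only if its representation on $KX^\omega$ is faithful.
   Context: $X$ is a finite alphabet with $|X|\ge 2$; $X^*$ is the free monoid on $X$ (finite words, empty word $\varepsilon$) and $X^\omega$ is the set of right infinite words. A self-similar group over $X$ is a group $G$ with a faithful action on $X^*$ by length-preserving permutations such that for all $g\in G$, $x\in X$ there is an element $g|_x\in G$ (the section of $g$ at $x$) with $g(xw)=g(x)\,g|_x(w)$ for all $w\in X^*$. Put $g|_\varepsilon=g$, $g|_{xv}=(g|_x)|_v$. $G$ also acts on $X^\omega$ by $g(x_1x_2\cdots)=g(x_1)\,g|_{x_1}(x_2)\,g|_{x_1x_2}(x_3)\cdots$. The associated inverse semigroup $S$ consists of $0$ and all (formally distinct) elements $ugv^*$ with $u,v\in X^*$, $g\in G$. Its product is determined by $(ugv^* )(whz^* )=u\,g(w')\,g|_{w'}h\,z^*$ if $w=vw'$; $(ugv^* )(whz^* )=u\,g\,h|_{h^{-1}(v')}\,(z\,h^{-1}(v'))^*$ if $v=wv'$; and $0$ if $v,w$ are not prefix-comparable. (Equivalently $gx=g(x)g|_x$ and $y^*x=\delta_{x,y}$ for $g\in G$, $x,y\in X$.) Its nonzero idempotents are the elements $ww^*$,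 $w\in X^*$, with $ww^*\le uu^*$ iff $u$ is a prefix of $w$. $E(S)$ is the semilattice of idempotents ($e\le f$ iff $ef=e$). $K_0S$ is the contracted semigroup algebra: the $K$-algebra with basis $S\setminus\{0\}$, with multiplication extending that of $S$ and the zero of $S$ identified with $0\in K$. The singular ideal $I_K(S)$ is the set of $a\in K_0S$ such that for all $0\ne e\in E(S)$ there is $0\neq f\in E(S)$ with $f\le e$ and $af=0$. A set $F\subseteq E(S)$ covers $e\in E(S)$ if $f\le e$ for all $f\in F$ and whenever $0\ne f'\le e$ in $E(S)$, then $f'f\neq 0$ for some $f\in F$. The tight ideal $\mathcal T_K(S)$ is the two-sided ideal of $K_0S$ generated by all products $\prod_{f\in F}(e-f)$ with $e\in E(S)$ and $F\subseteq E(S)$ a finite cover of $e$. The Nekrashevych algebra $\mathcal N_K(G,X)$ is the quotient of $K_0S$ by the two-sided ideal generated by $1-\sum_{x\in X}xx^*$ (the Cuntz–Krieger ideal); this ideal equals $\mathcal T_K(S)$. An algebra is simple if it is nonzero and has no two-sided ideals other than $0$ and itself. $S$ acts on $X^\omega$ by partial injective maps: $ugv^*$ has domain $vX^\omega$ and sends $vw\mapsto u\,g(w)$. $KX^\omega$ is the $K$-vector space with basis $X^\omega$, and the representation of $K_0S$ on it is the linear extension of this partial action, where an undefined action of $s\in S$ on $w\in X^\omega$ is set to be $0$. The Cuntz–Krieger ideal acts as zero, so this induces a representation of $\mathcal N_K(G,X)$ on $KX^\omega$. *)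

theory Defs
  imports Complex_Main "HOL-Algebra.QuotRing" "HOL-Algebra.Group_Action" "HOL-Library.Sublist" "HOL-Library.Stream"
    "HOL-Library.Poly_Mapping"
begin

section \<open>The contracted algebra of a monoid with zero\<close>

text \<open>
  Throughout, \<open>S\<close> is a monoid with carrier and \<open>z\<close> is its zero element. Vectors of a free
  \<open>K\<close>-vector space are finitely supported functions with values in a type \<open>'k\<close> of class
  \<^class>\<open>field\<close>. \<open>csingle z s c\<close> is \<open>c\<close> times the image of \<open>s\<close> in \<open>K\<^sub>0S\<close>, where \<open>z\<close> becomes \<open>0\<close>.
\<close>

definition csingle :: "'s \<Rightarrow> 's \<Rightarrow> 'k \<Rightarrow> ('s \<Rightarrow>\<^sub>0 'k::field)" where
  "csingle z s c = (if s = z then 0 else Poly_Mapping.single s c)"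

definition contracted_algebra :: "('s, 'm) monoid_scheme \<Rightarrow> 's \<Rightarrow> ('s \<Rightarrow>\<^sub>0 'k::field) ring" where
  "contracted_algebra S z =
    \<lparr>carrier = {a. Poly_Mapping.keys a \<subseteq> carrier S - {z}},
     mult = (\<lambda>a b. \<Sum>s\<in>Poly_Mapping.keys a. \<Sum>t\<in>Poly_Mapping.keys b.
               csingle z (s \<otimes>\<^bsub>S\<^esub> t) (Poly_Mapping.lookup a s * Poly_Mapping.lookup b t)),
     one = csingle z \<one>\<^bsub>S\<^esub> 1,
     zero = 0,
     add = (+)\<rparr>"

definition idempotents :: "('s, 'm) monoid_scheme \<Rightarrow> 's set" where
  "idempotents S = {e \<in> carrier S. e \<otimes>\<^bsub>S\<^esub> e = e}"

definition idem_le :: "('s, 'm) monoid_scheme \<Rightarrow> 's \<Rightarrow> 's \<Rightarrow> bool" where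
  "idem_le S e f \<longleftrightarrow> e \<otimes>\<^bsub>S\<^esub> f = e"

definition singular_ideal :: "('s, 'm) monoid_scheme \<Rightarrow> 's \<Rightarrow> ('s \<Rightarrow>\<^sub>0 'k::field) set" where
  "singular_ideal S z =
    {a \<in> carrier (contracted_algebra S z).
      \<forall>e\<in>idempotents S. e \<noteq> z \<longrightarrow>
        (\<exists>f\<in>idempotents S. f \<noteq> z \<and> idem_le S f e \<and>
          a \<otimes>\<^bsub>contracted_algebra S z\<^esub> csingle z f 1 = 0)}"

definition covers :: "('s, 'm) monoid_scheme \<Rightarrow> 's \<Rightarrow> 's set \<Rightarrow> 's \<Rightarrow> bool" where
  "covers S z F e \<longleftrightarrow>
    F \<subseteq> idempotents S \<and> (\<forall>f\<in>F. idem_le S f e) \<and>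
    (\<forall>f'\<in>idempotents S. f' \<noteq> z \<and> idem_le S f' e \<longrightarrow> (\<exists>f\<in>F. f' \<otimes>\<^bsub>S\<^esub> f \<noteq> z))"

text \<open>
  The product of the \<open>e - f\<close> over a finite set \<open>F\<close> is written as a product along an enumeration
  \<open>fs\<close> of \<open>F\<close>, starting from \<open>e\<close>. The factor \<open>e\<close> is absorbed by any \<open>e - f\<close> with \<open>f \<le> e\<close>;
  it only matters for the empty cover of \<open>e = 0\<close>, whose empty product is thereby read in
  \<open>e K\<^sub>0S e\<close> (so it is \<open>0\<close>, not \<open>1\<close>).
\<close>

definition cover_product ::
    "('s, 'm) monoid_scheme \<Rightarrow> 's \<Rightarrow> 's \<Rightarrow> 's list \<Rightarrow> ('s \<Rightarrow>\<^sub>0 'k::field)" where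
  "cover_product S z e fs =
    foldr (\<lambda>f a. (csingle z e 1 - csingle z f 1) \<otimes>\<^bsub>contracted_algebra S z\<^esub> a) fs (csingle z e 1)"

definition tight_ideal :: "('s, 'm) monoid_scheme \<Rightarrow> 's \<Rightarrow> ('s \<Rightarrow>\<^sub>0 'k::field) set" where
  "tight_ideal S z = genideal (contracted_algebra S z)
    {cover_product S z e fs | e fs. e \<in> idempotents S \<and> distinct fs \<and> covers S z (set fs) e}"

text \<open>
  The algebras considered here are unital, so ring ideals are automatically \<open>K\<close>-subspaces.
\<close>

definition simple_algebra :: "('a, 'm) ring_scheme \<Rightarrow> bool" where
  "simple_algebra A \<longleftrightarrow> ring A \<and> carrier A \<noteq> {\<zero>\<^bsub>A\<^esub>} \<and>
    (\<forall>I. ideal I A \<longrightarrow> I = {\<zero>\<^bsub>A\<^esub>} \<or> I = carrier A)"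


section \<open>Self-similar groups\<close>

text \<open>The alphabet is the finite type \<open>'x\<close>, so \<open>X\<^sup>*\<close> is \<open>'x list\<close> and \<open>X\<^sup>\<omega>\<close> is \<open>'x stream\<close>.\<close>

locale self_similar_group = faithful_action G "UNIV :: 'x list set" \<phi>
  for G :: "('g, 'm) monoid_scheme" (structure) and \<phi> :: "'g \<Rightarrow> 'x::finite list \<Rightarrow> 'x list" +
  assumes card_alphabet: "2 \<le> card (UNIV :: 'x set)"
    and length_preserving: "g \<in> carrier G \<Longrightarrow> length (\<phi> g w) = length w"
    and self_similar: "g \<in> carrier G \<Longrightarrow> \<exists>h\<in>carrier G. \<forall>w. \<phi> g (x # w) = \<phi> g [x] @ \<phi> h w"

text \<open>The element \<open>h\<close> above is unique because the action is faithful.\<close>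

definition letter_sect ::
    "('g, 'm) monoid_scheme \<Rightarrow> ('g \<Rightarrow> 'x list \<Rightarrow> 'x list) \<Rightarrow> 'g \<Rightarrow> 'x \<Rightarrow> 'g" where
  "letter_sect G \<phi> g x = (THE h. h \<in> carrier G \<and> (\<forall>w. \<phi> g (x # w) = \<phi> g [x] @ \<phi> h w))"

primrec sect ::
    "('g, 'm) monoid_scheme \<Rightarrow> ('g \<Rightarrow> 'x list \<Rightarrow> 'x list) \<Rightarrow> 'g \<Rightarrow> 'x list \<Rightarrow> 'g" where
  "sect G \<phi> g [] = g"
| "sect G \<phi> g (x # v) = sect G \<phi> (letter_sect G \<phi> g x) v"

primcorec stream_act ::
    "('g, 'm) monoid_scheme \<Rightarrow> ('g \<Rightarrow> 'x list \<Rightarrow> 'x list) \<Rightarrow> 'g \<Rightarrow> 'x stream \<Rightarrow> 'x stream" where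
  "shd (stream_act G \<phi> g w) = hd (\<phi> g [shd w])"
| "stl (stream_act G \<phi> g w) = stream_act G \<phi> (letter_sect G \<phi> g (shd w)) (stl w)"


section \<open>The associated inverse semigroup\<close>

text \<open>\<open>Elem u g v\<close> is the formal element \<open>u g v\<^sup>*\<close>.\<close>

datatype ('x, 'g) iselem = Zero | Elem "'x list" 'g "'x list"

fun is_mult :: "('g, 'm) monoid_scheme \<Rightarrow> ('g \<Rightarrow> 'x list \<Rightarrow> 'x list) \<Rightarrow>
    ('x, 'g) iselem \<Rightarrow> ('x, 'g) iselem \<Rightarrow> ('x, 'g) iselem" where
  "is_mult G \<phi> (Elem u g v) (Elem w h z) =
    (if prefix v w then
       let w' = drop (length v) w
       in Elem (u @ \<phi> g w') (sect G \<phi> g w' \<otimes>\<^bsub>G\<^esub> h) z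
     else if prefix w v then
       let v' = drop (length w) v; v'' = \<phi> (inv\<^bsub>G\<^esub> h) v'
       in Elem u (g \<otimes>\<^bsub>G\<^esub> sect G \<phi> h v'') (z @ v'')
     else Zero)"
| "is_mult G \<phi> _ _ = Zero"

definition inv_semigroup ::
    "('g, 'm) monoid_scheme \<Rightarrow> ('g \<Rightarrow> 'x list \<Rightarrow> 'x list) \<Rightarrow> ('x, 'g) iselem monoid" where
  "inv_semigroup G \<phi> =
    \<lparr>carrier = insert Zero {Elem u g v | u g v. g \<in> carrier G},
     mult = is_mult G \<phi>,
     one = Elem [] \<one>\<^bsub>G\<^esub> []\<rparr>"

abbreviation K0S :: "('g, 'm) monoid_scheme \<Rightarrow> ('g \<Rightarrow> 'x list \<Rightarrow> 'x list) \<Rightarrow>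
    (('x, 'g) iselem \<Rightarrow>\<^sub>0 'k::field) ring" where
  "K0S G \<phi> \<equiv> contracted_algebra (inv_semigroup G \<phi>) Zero"

definition cuntz_krieger_ideal :: "('g, 'm) monoid_scheme \<Rightarrow>
    ('g \<Rightarrow> 'x::finite list \<Rightarrow> 'x list) \<Rightarrow> (('x, 'g) iselem \<Rightarrow>\<^sub>0 'k::field) set" where
  "cuntz_krieger_ideal G \<phi> = genideal (K0S G \<phi>)
    {\<one>\<^bsub>K0S G \<phi>\<^esub> - (\<Sum>x\<in>UNIV. Poly_Mapping.single (Elem [x] \<one>\<^bsub>G\<^esub> [x]) 1)}"

definition nekrashevych_algebra :: "('g, 'm) monoid_scheme \<Rightarrow>
    ('g \<Rightarrow> 'x::finite list \<Rightarrow> 'x list) \<Rightarrow> (('x, 'g) iselem \<Rightarrow>\<^sub>0 'k::field) set ring" where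
  "nekrashevych_algebra G \<phi> = K0S G \<phi> Quot cuntz_krieger_ideal G \<phi>"


section \<open>The representation on the space with basis the infinite words\<close>

definition vscale :: "'k \<Rightarrow> ('b \<Rightarrow>\<^sub>0 'k) \<Rightarrow> ('b \<Rightarrow>\<^sub>0 'k::field)" where
  "vscale c = Poly_Mapping.map ((*) c)"

definition End_ring :: "(('b \<Rightarrow>\<^sub>0 'k) \<Rightarrow> ('b \<Rightarrow>\<^sub>0 'k::field)) ring" where
  "End_ring =
    \<lparr>carrier = {T. Vector_Spaces.linear vscale vscale T},
     mult = (\<circ>), one = id, zero = (\<lambda>_. 0), add = (\<lambda>T U v. T v + U v)\<rparr>"

fun partial_act :: "('g, 'm) monoid_scheme \<Rightarrow> ('g \<Rightarrow> 'x list \<Rightarrow> 'x list) \<Rightarrow>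
    ('x, 'g) iselem \<Rightarrow> 'x stream \<Rightarrow> 'x stream option" where
  "partial_act G \<phi> Zero w = None"
| "partial_act G \<phi> (Elem u g v) w =
    (if stake (length v) w = v
     then Some (u @- stream_act G \<phi> g (sdrop (length v) w)) else None)"

definition stream_rep :: "('g, 'm) monoid_scheme \<Rightarrow> ('g \<Rightarrow> 'x list \<Rightarrow> 'x list) \<Rightarrow>
    (('x, 'g) iselem \<Rightarrow>\<^sub>0 'k::field) \<Rightarrow> ('x stream \<Rightarrow>\<^sub>0 'k) \<Rightarrow> ('x stream \<Rightarrow>\<^sub>0 'k)" where
  "stream_rep G \<phi> a v =
    (\<Sum>s\<in>Poly_Mapping.keys a. \<Sum>w\<in>Poly_Mapping.keys v.
      case partial_act G \<phi> s w of
        None \<Rightarrow> 0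
      | Some w' \<Rightarrow> Poly_Mapping.single w' (Poly_Mapping.lookup a s * Poly_Mapping.lookup v w))"

text \<open>
  An element of the Nekrashevych algebra is a coset \<open>C\<close>; all its members act in the same way,
  and the coset acts as they do.
\<close>

definition nekrashevych_rep :: "('g, 'm) monoid_scheme \<Rightarrow> ('g \<Rightarrow> 'x list \<Rightarrow> 'x list) \<Rightarrow>
    (('x, 'g) iselem \<Rightarrow>\<^sub>0 'k::field) set \<Rightarrow> ('x stream \<Rightarrow>\<^sub>0 'k) \<Rightarrow> ('x stream \<Rightarrow>\<^sub>0 'k)" where
  "nekrashevych_rep G \<phi> C = the_elem (stream_rep G \<phi> ` C)"

section \<open>The definitions are well posed\<close>

subsection \<open>The contracted algebra is a ring\<close>

lemma csingle_0 [simp]: "csingle z s 0 = 0"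
  by (simp add: csingle_def)

lemma csingle_zero [simp]: "csingle z z c = 0"
  by (simp add: csingle_def)

lemma csingle_add: "csingle z s (c + d) = csingle z s c + csingle z s d"
  by (simp add: csingle_def single_add)

lemma keys_csingle: "Poly_Mapping.keys (csingle z s c) \<subseteq> {s} - {z}"
  by (auto simp: csingle_def)

lemma keys_sum_subset: "Poly_Mapping.keys (\<Sum>i\<in>I. f i) \<subseteq> (\<Union>i\<in>I. Poly_Mapping.keys (f i))"
proof (induction I rule: infinite_finite_induct)
  case (insert x F)
  then show ?case using Poly_Mapping.keys_add[of "f x" "sum f F"] by auto
qed auto

lemma sum_single_self:
  assumes "finite A" "Poly_Mapping.keys a \<subseteq> A"
  shows "(\<Sum>s\<in>A. Poly_Mapping.single s (Poly_Mapping.lookup a s)) = a"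
proof (rule poly_mapping_eqI)
  fix k
  have "Poly_Mapping.lookup (\<Sum>s\<in>A. Poly_Mapping.single s (Poly_Mapping.lookup a s)) k =
     (\<Sum>s\<in>A. if s = k then Poly_Mapping.lookup a s else 0)"
    by (simp add: lookup_sum lookup_single when_def)
  also have "\<dots> = Poly_Mapping.lookup a k"
    using assms by (auto simp: in_keys_iff)
  finally show "Poly_Mapping.lookup (\<Sum>s\<in>A. Poly_Mapping.single s (Poly_Mapping.lookup a s)) k = Poly_Mapping.lookup a k" .
qed

locale monoid_with_zero = monoid S for S :: "('s, 'm) monoid_scheme" (structure) and z :: 's +
  assumes z_closed [simp]: "z \<in> carrier S"
    and z_left [simp]: "s \<in> carrier S \<Longrightarrow> z \<otimes> s = z"
    and z_right [simp]: "s \<in> carrier S \<Longrightarrow> s \<otimes> z = z"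
begin

definition cm :: "('s \<Rightarrow>\<^sub>0 'k::field) \<Rightarrow> ('s \<Rightarrow>\<^sub>0 'k) \<Rightarrow> ('s \<Rightarrow>\<^sub>0 'k)" where
  "cm a b = a \<otimes>\<^bsub>contracted_algebra S z\<^esub> b"

lemma cm_eq:
  assumes "finite A" "Poly_Mapping.keys a \<subseteq> A" "finite B" "Poly_Mapping.keys b \<subseteq> B"
  shows "cm a b = (\<Sum>s\<in>A. \<Sum>t\<in>B. csingle z (s \<otimes> t) (Poly_Mapping.lookup a s * Poly_Mapping.lookup b t))"
proof -
  have "cm a b = (\<Sum>s\<in>Poly_Mapping.keys a. \<Sum>t\<in>Poly_Mapping.keys b. csingle z (s \<otimes> t) (Poly_Mapping.lookup a s * Poly_Mapping.lookup b t))"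
    by (simp add: cm_def contracted_algebra_def)
  also have "\<dots> = (\<Sum>s\<in>Poly_Mapping.keys a. \<Sum>t\<in>B. csingle z (s \<otimes> t) (Poly_Mapping.lookup a s * Poly_Mapping.lookup b t))"
    using assms by (intro sum.cong refl sum.mono_neutral_left) (auto simp: in_keys_iff)
  also have "\<dots> = (\<Sum>s\<in>A. \<Sum>t\<in>B. csingle z (s \<otimes> t) (Poly_Mapping.lookup a s * Poly_Mapping.lookup b t))"
    using assms by (intro sum.mono_neutral_left) (auto simp: in_keys_iff)
  finally show ?thesis .
qed

lemma cm_add_left: "cm (a + b) c = cm a c + cm b c"
proof -
  let ?A = "Poly_Mapping.keys a \<union> Poly_Mapping.keys b"
  have "Poly_Mapping.keys (a + b) \<subseteq> ?A" by (rule Poly_Mapping.keys_add)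
  then show ?thesis
    by (subst (1 2 3) cm_eq[where A = ?A and B = "Poly_Mapping.keys c"])
      (auto simp: lookup_add distrib_right csingle_add sum.distrib)
qed

lemma cm_add_right: "cm c (a + b) = cm c a + cm c b"
proof -
  let ?A = "Poly_Mapping.keys a \<union> Poly_Mapping.keys b"
  have "Poly_Mapping.keys (a + b) \<subseteq> ?A" by (rule Poly_Mapping.keys_add)
  then show ?thesis
    by (subst (1 2 3) cm_eq[where B = ?A and A = "Poly_Mapping.keys c"])
      (auto simp: lookup_add distrib_left csingle_add sum.distrib)
qed

lemma cm_0 [simp]: "cm 0 a = 0" "cm a 0 = 0"
  by (simp_all add: cm_def contracted_algebra_def)

lemma cm_sum_left: "cm (\<Sum>i\<in>I. f i) c = (\<Sum>i\<in>I. cm (f i) c)"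
  by (induction I rule: infinite_finite_induct) (auto simp: cm_add_left)

lemma cm_sum_right: "cm c (\<Sum>i\<in>I. f i) = (\<Sum>i\<in>I. cm c (f i))"
  by (induction I rule: infinite_finite_induct) (auto simp: cm_add_right)

lemma cm_single: "cm (Poly_Mapping.single s c) (Poly_Mapping.single t d) = csingle z (s \<otimes> t) (c * d)"
  by (subst cm_eq[where A="{s}" and B="{t}"]) auto

lemma cm_csingle:
  assumes "s \<in> carrier S" "t \<in> carrier S"
  shows "cm (csingle z s c) (csingle z t d) = csingle z (s \<otimes> t) (c * d)"
  using assms by (auto simp: csingle_def[of z s] csingle_def[of z t] cm_single)

lemma sum_csingle_self:
  assumes "Poly_Mapping.keys a \<subseteq> carrier S - {z}"
  shows "(\<Sum>s\<in>Poly_Mapping.keys a. csingle z s (Poly_Mapping.lookup a s)) = a"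
proof -
  have "(\<Sum>s\<in>Poly_Mapping.keys a. csingle z s (Poly_Mapping.lookup a s)) =
     (\<Sum>s\<in>Poly_Mapping.keys a. Poly_Mapping.single s (Poly_Mapping.lookup a s))"
    using assms by (intro sum.cong) (auto simp: csingle_def)
  then show ?thesis by (simp add: sum_single_self)
qed

lemma csingle_in:
  assumes "s \<in> carrier S"
  shows "Poly_Mapping.keys (csingle z s c) \<subseteq> carrier S - {z}"
  using assms by (auto simp: csingle_def)

lemma cm_assoc_csingle:
  assumes "s \<in> carrier S" "t \<in> carrier S" "r \<in> carrier S"
  shows "cm (cm (csingle z s c) (csingle z t d)) (csingle z r e) = cm (csingle z s c) (cm (csingle z t d) (csingle z r e))"
  by (simp only: cm_csingle assms m_closed m_assoc mult.assoc)

lemma cm_assoc: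
  assumes "Poly_Mapping.keys a \<subseteq> carrier S - {z}" "Poly_Mapping.keys b \<subseteq> carrier S - {z}" "Poly_Mapping.keys c \<subseteq> carrier S - {z}"
  shows "cm (cm a b) c = cm a (cm b c)"
proof -
  define A where "A = Poly_Mapping.keys a"
  define B where "B = Poly_Mapping.keys b"
  define C where "C = Poly_Mapping.keys c"
  have sub: "A \<subseteq> carrier S" "B \<subseteq> carrier S" "C \<subseteq> carrier S"
    using assms by (auto simp: A_def B_def C_def)
  define sa where "sa = (\<lambda>s. csingle z s (Poly_Mapping.lookup a s))"
  define sb where "sb = (\<lambda>s. csingle z s (Poly_Mapping.lookup b s))"
  define sc where "sc = (\<lambda>s. csingle z s (Poly_Mapping.lookup c s))"
  have eqs: "a = sum sa A" "b = sum sb B" "c = sum sc C"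
    using assms by (simp_all add: sum_csingle_self A_def B_def C_def sa_def sb_def sc_def)
  have "cm (cm (sa i) (sb j)) (sc k) = cm (sa i) (cm (sb j) (sc k))"
    if "i \<in> A" "j \<in> B" "k \<in> C" for i j k
    unfolding sa_def sb_def sc_def by (rule cm_assoc_csingle) (use that sub in auto)
  then show ?thesis
    unfolding eqs cm_sum_left cm_sum_right by (intro sum.cong refl)
qed

lemma cm_closed:
  assumes "Poly_Mapping.keys a \<subseteq> carrier S - {z}" "Poly_Mapping.keys b \<subseteq> carrier S - {z}"
  shows "Poly_Mapping.keys (cm a b) \<subseteq> carrier S - {z}"
proof -
  have "Poly_Mapping.keys (cm a b) \<subseteq> (\<Union>s\<in>Poly_Mapping.keys a. \<Union>t\<in>Poly_Mapping.keys b. carrier S - {z})"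
    unfolding cm_eq[OF finite_keys subset_refl finite_keys subset_refl]
    by (intro order_trans[OF keys_sum_subset] UN_mono subset_refl csingle_in m_closed) (use assms in auto)
  then show ?thesis by auto
qed

lemma cm_one:
  assumes "Poly_Mapping.keys a \<subseteq> carrier S - {z}"
  shows "cm (csingle z \<one> 1) a = a" "cm a (csingle z \<one> 1) = a"
proof -
  have "cm (csingle z \<one> 1) (\<Sum>s\<in>Poly_Mapping.keys a. csingle z s (Poly_Mapping.lookup a s)) = (\<Sum>s\<in>Poly_Mapping.keys a. csingle z s (Poly_Mapping.lookup a s))"
    unfolding cm_sum_right using assms by (intro sum.cong refl) (subst cm_csingle, auto)
  then show "cm (csingle z \<one> 1) a = a" using assms by (simp add: sum_csingle_self)
  have "cm (\<Sum>s\<in>Poly_Mapping.keys a. csingle z s (Poly_Mapping.lookup a s)) (csingle z \<one> 1) = (\<Sum>s\<in>Poly_Mapping.keys a. csingle z s (Poly_Mapping.lookup a s))"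
    unfolding cm_sum_left using assms by (intro sum.cong refl) (subst cm_csingle, auto)
  then show "cm a (csingle z \<one> 1) = a" using assms by (simp add: sum_csingle_self)
qed

lemma ring_contracted_algebra: "ring (contracted_algebra S z :: ('s \<Rightarrow>\<^sub>0 'k::field) ring)"
proof -
  let ?R = "contracted_algebra S z :: ('s \<Rightarrow>\<^sub>0 'k) ring"
  have carr: "x \<in> carrier ?R \<longleftrightarrow> Poly_Mapping.keys x \<subseteq> carrier S - {z}" for x
    by (simp add: contracted_algebra_def)
  have [simp]: "add ?R = (+)" "zero ?R = 0" "one ?R = csingle z \<one> 1"
    by (simp_all add: contracted_algebra_def)
  note [simp] = cm_def[symmetric]
  show ?thesis
  proof (rule ringI)
    show "abelian_group ?R"
    proof (rule abelian_groupI)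
      fix x y assume "x \<in> carrier ?R" "y \<in> carrier ?R"
      then show "x \<oplus>\<^bsub>?R\<^esub> y \<in> carrier ?R"
        using Poly_Mapping.keys_add[of x y] by (auto simp: carr)
    next
      fix x assume "x \<in> carrier ?R"
      then show "\<exists>y\<in>carrier ?R. y \<oplus>\<^bsub>?R\<^esub> x = \<zero>\<^bsub>?R\<^esub>"
        by (intro bexI[of _ "-x"]) (auto simp: carr)
    qed (auto simp: carr algebra_simps)
    show "monoid ?R"
      by (rule monoidI; unfold carr) (simp_all only: cm_def[symmetric] \<open>one ?R = csingle z \<one> 1\<close> cm_closed cm_assoc cm_one csingle_in one_closed)
  qed (auto simp: cm_add_left cm_add_right)
qed

end

subsection \<open>Sections, and the inverse semigroup as a semigroup of partial maps\<close>

context self_similar_group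
begin

lemma is_group: "group G"
  using group_hom group_hom.axioms(1) by blast

sublocale Gr: group G by (rule is_group)

lemma act_mult: "g \<in> carrier G \<Longrightarrow> h \<in> carrier G \<Longrightarrow> \<phi> (g \<otimes> h) w = \<phi> g (\<phi> h w)"
  using composition_rule by simp

lemma act_one [simp]: "\<phi> \<one> w = w"
  using id_eq_one by (metis UNIV_I restrict_apply')

lemma act_inv: "g \<in> carrier G \<Longrightarrow> \<phi> (inv g) (\<phi> g w) = w"
  by (simp add: act_mult[symmetric])

lemma act_inv': "g \<in> carrier G \<Longrightarrow> \<phi> g (\<phi> (inv g) w) = w"
  by (simp add: act_mult[symmetric])

lemma act_eqI:
  assumes "g \<in> carrier G" "h \<in> carrier G" "\<And>w. \<phi> g w = \<phi> h w"
  shows "g = h"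
  using faithful assms by (meson ext inj_on_def)

lemma act_Nil [simp]: "g \<in> carrier G \<Longrightarrow> \<phi> g [] = []"
  using length_preserving[of g "[]"] by simp

lemma letter_sect:
  assumes "g \<in> carrier G"
  shows "letter_sect G \<phi> g x \<in> carrier G"
    and "\<phi> g (x # w) = \<phi> g [x] @ \<phi> (letter_sect G \<phi> g x) w"
proof -
  obtain h where h: "h \<in> carrier G" "\<forall>w. \<phi> g (x # w) = \<phi> g [x] @ \<phi> h w"
    using self_similar[OF assms] by blast
  have "letter_sect G \<phi> g x = h"
    unfolding letter_sect_def
  proof (rule the_equality)
    show "h \<in> carrier G \<and> (\<forall>w. \<phi> g (x # w) = \<phi> g [x] @ \<phi> h w)" using h by blast
    fix h' assume "h' \<in> carrier G \<and> (\<forall>w. \<phi> g (x # w) = \<phi> g [x] @ \<phi> h' w)"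
    with h show "h' = h" by (metis act_eqI same_append_eq)
  qed
  then show "letter_sect G \<phi> g x \<in> carrier G"
    and "\<phi> g (x # w) = \<phi> g [x] @ \<phi> (letter_sect G \<phi> g x) w"
    using h by blast+
qed

lemma sect_closed [simp]: "g \<in> carrier G \<Longrightarrow> sect G \<phi> g v \<in> carrier G"
  by (induction v arbitrary: g) (auto simp: letter_sect)

lemma act_append: "g \<in> carrier G \<Longrightarrow> \<phi> g (v @ w) = \<phi> g v @ \<phi> (sect G \<phi> g v) w"
proof (induction v arbitrary: g)
  case (Cons x v)
  have "\<phi> g (x # v @ w) = \<phi> g [x] @ \<phi> (letter_sect G \<phi> g x) (v @ w)"
    using Cons.prems by (rule letter_sect)
  also have "\<dots> = \<phi> g [x] @ \<phi> (letter_sect G \<phi> g x) v @ \<phi> (sect G \<phi> (letter_sect G \<phi> g x) v) w"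
    using Cons letter_sect(1) by simp
  also have "\<dots> = \<phi> g (x # v) @ \<phi> (sect G \<phi> (letter_sect G \<phi> g x) v) w"
    using letter_sect(2)[OF Cons.prems, of x v] by simp
  finally show ?case by simp
qed simp

lemma sect_eqI:
  assumes "g \<in> carrier G" "h \<in> carrier G" "\<And>w. \<phi> g (v @ w) = \<phi> g v @ \<phi> h w"
  shows "sect G \<phi> g v = h"
  by (rule act_eqI) (use assms act_append[of g v] in auto)

lemma sect_append: "sect G \<phi> g (v @ w) = sect G \<phi> (sect G \<phi> g v) w"
  by (induction v arbitrary: g) auto

lemma sect_mult:
  assumes "g \<in> carrier G" "h \<in> carrier G"
  shows "sect G \<phi> (g \<otimes> h) w = sect G \<phi> g (\<phi> h w) \<otimes> sect G \<phi> h w"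
proof (rule sect_eqI)
  show "\<phi> (g \<otimes> h) (w @ v) = \<phi> (g \<otimes> h) w @ \<phi> (sect G \<phi> g (\<phi> h w) \<otimes> sect G \<phi> h w) v" for v
    using assms act_append[of h w v] act_append[of g "\<phi> h w" "\<phi> (sect G \<phi> h w) v"] by (simp add: act_mult)
qed (use assms in auto)

lemma sect_one [simp]: "sect G \<phi> \<one> w = \<one>"
  by (rule sect_eqI) auto

lemma stream_act_Cons: "g \<in> carrier G \<Longrightarrow> stream_act G \<phi> g (x ## w) = \<phi> g [x] @- stream_act G \<phi> (letter_sect G \<phi> g x) w"
proof -
  assume g: "g \<in> carrier G"
  obtain y where y: "\<phi> g [x] = [y]"
    using length_preserving[OF g, of "[x]"] by (auto simp: length_Suc_conv)
  show ?thesis by (subst stream_act.ctr) (simp add: y)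
qed

lemma stream_act_shift: "g \<in> carrier G \<Longrightarrow> stream_act G \<phi> g (v @- w) = \<phi> g v @- stream_act G \<phi> (sect G \<phi> g v) w"
proof (induction v arbitrary: g)
  case (Cons x v)
  then show ?case
    using letter_sect(1)[OF Cons.prems] letter_sect(2)[OF Cons.prems, of x v] by (simp add: stream_act_Cons)
qed simp

lemma stake_stream_act: "g \<in> carrier G \<Longrightarrow> stake n (stream_act G \<phi> g w) = \<phi> g (stake n w)"
proof -
  assume g: "g \<in> carrier G"
  have "stream_act G \<phi> g w = \<phi> g (stake n w) @- stream_act G \<phi> (sect G \<phi> g (stake n w)) (sdrop n w)"
    using stream_act_shift[OF g, of "stake n w" "sdrop n w"] by (simp add: stake_sdrop)
  then show ?thesis using length_preserving[OF g, of "stake n w"] by (simp add: stake_shift)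
qed

lemma stream_eqI: assumes "\<And>n. stake n s = stake n t" shows "s = t"
proof -
  have "s !! n = t !! n" for n
  proof -
    have "s !! n = stake (Suc n) s ! n" by (rule stake_nth[symmetric]) simp
    also have "\<dots> = stake (Suc n) t ! n" by (simp only: assms)
    also have "\<dots> = t !! n" by (rule stake_nth) simp
    finally show ?thesis .
  qed
  then have "smap (\<lambda>x. x) s = t" by (subst smap_alt) auto
  then show ?thesis by (simp add: stream.map_ident)
qed

lemma stream_act_mult:
  assumes "g \<in> carrier G" "h \<in> carrier G"
  shows "stream_act G \<phi> (g \<otimes> h) w = stream_act G \<phi> g (stream_act G \<phi> h w)"
  by (rule stream_eqI) (use assms in \<open>simp add: stake_stream_act act_mult\<close>)

lemma stream_act_one [simp]: "stream_act G \<phi> \<one> w = w"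
  by (rule stream_eqI) (simp add: stake_stream_act)

abbreviation "IS \<equiv> inv_semigroup G \<phi>"

lemma is_mult1: "is_mult G \<phi> (Elem u g v) (Elem (v @ w) h z) = Elem (u @ \<phi> g w) (sect G \<phi> g w \<otimes> h) z"
  by simp

lemma is_mult2:
  assumes "g \<in> carrier G" "h \<in> carrier G"
  shows "is_mult G \<phi> (Elem u g (w @ v)) (Elem w h z) =
    Elem u (g \<otimes> sect G \<phi> h (\<phi> (inv h) v)) (z @ \<phi> (inv h) v)"
  using assms by (cases "v = []") (auto simp: Let_def)

lemma is_mult3: "\<not> prefix v w \<Longrightarrow> \<not> prefix w v \<Longrightarrow> is_mult G \<phi> (Elem u g v) (Elem w h z) = Zero"
  by simp

lemma is_mult_closed: "s \<in> carrier IS \<Longrightarrow> t \<in> carrier IS \<Longrightarrow> is_mult G \<phi> s t \<in> carrier IS"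
  by (cases s; cases t) (auto simp: inv_semigroup_def Let_def)

lemma is_mult_Zero [simp]: "is_mult G \<phi> s Zero = Zero"
  by (cases s) auto

lemma shift_eq: "stake (length v) w = v \<longleftrightarrow> (\<exists>w'. w = v @- w')"
proof
  assume a: "stake (length v) w = v"
  have "w = v @- sdrop (length v) w" using stake_sdrop[of "length v" w] unfolding a by simp
  then show "\<exists>w'. w = v @- w'" by blast
qed (auto simp: stake_shift)

lemma partial_act_shift [simp]: "partial_act G \<phi> (Elem u g v) (v @- w) = Some (u @- stream_act G \<phi> g w)"
  by (simp add: stake_shift sdrop_shift)

lemma partial_act_none: "\<nexists>w'. w = v @- w' \<Longrightarrow> partial_act G \<phi> (Elem u g v) w = None"
  using shift_eq[of v w] by simp

lemma partial_act_mult: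
  assumes "s \<in> carrier IS" "t \<in> carrier IS"
  shows "partial_act G \<phi> (is_mult G \<phi> s t) \<xi> =
    (case partial_act G \<phi> t \<xi> of None \<Rightarrow> None | Some \<eta> \<Rightarrow> partial_act G \<phi> s \<eta>)"
proof (cases s; cases t)
  fix u g v w h z assume st: "s = Elem u g v" "t = Elem w h z"
  then have gh: "g \<in> carrier G" "h \<in> carrier G" using assms by (auto simp: inv_semigroup_def)
  consider (1) w' where "w = v @ w'" | (2) v' where "v = w @ v'" | (3) "\<not> prefix v w" "\<not> prefix w v"
    by (auto simp: prefix_def)
  then show ?thesis
  proof cases
    case 1
    show ?thesis
    proof (cases "\<exists>\<xi>'. \<xi> = z @- \<xi>'")
      case True
      then obtain \<xi>' where x: "\<xi> = z @- \<xi>'" by blast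
      show ?thesis unfolding st 1 is_mult1 x partial_act_shift
        using partial_act_shift[of u g v "w' @- stream_act G \<phi> h \<xi>'"] gh
        by (simp add: stream_act_shift stream_act_mult)
    next
      case False
      then have "partial_act G \<phi> (Elem u g z) \<xi> = None" for u g by (rule partial_act_none)
      then show ?thesis unfolding st 1 is_mult1 by (simp only: option.case)
    qed
  next
    case 2
    show ?thesis
    proof (cases "\<exists>\<xi>'. \<xi> = z @- \<xi>'")
      case True
      then obtain \<xi>' where x: "\<xi> = z @- \<xi>'" by blast
      let ?v = "\<phi> (inv h) v'"
      have R: "(case partial_act G \<phi> t \<xi> of None \<Rightarrow> None | Some \<eta> \<Rightarrow> partial_act G \<phi> s \<eta>) =
          partial_act G \<phi> s (w @- stream_act G \<phi> h \<xi>')"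
        unfolding st x partial_act_shift by simp
      show ?thesis
      proof (cases "\<exists>\<zeta>. \<xi>' = ?v @- \<zeta>")
        case True
        then obtain \<zeta> where z: "\<xi>' = ?v @- \<zeta>" by blast
        have "stream_act G \<phi> h \<xi>' = v' @- stream_act G \<phi> (sect G \<phi> h ?v) \<zeta>"
          using gh by (simp add: z stream_act_shift act_inv')
        then have "partial_act G \<phi> s (w @- stream_act G \<phi> h \<xi>') = 
           Some (u @- stream_act G \<phi> g (stream_act G \<phi> (sect G \<phi> h ?v) \<zeta>))"
          using partial_act_shift[of u g v "stream_act G \<phi> (sect G \<phi> h ?v) \<zeta>"] by (simp add: st 2 del: partial_act.simps)
        moreover have "partial_act G \<phi> (is_mult G \<phi> s t) \<xi> = Some (u @- stream_act G \<phi> (g \<otimes> sect G \<phi> h ?v) \<zeta>)"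
          unfolding st 2 is_mult2[OF gh] x z
          using partial_act_shift[of u "g \<otimes> sect G \<phi> h ?v" "z @ ?v" \<zeta>] by (simp del: partial_act.simps)
        ultimately show ?thesis using gh R by (simp add: stream_act_mult)
      next
        case False
        have "\<nexists>\<zeta>. stream_act G \<phi> h \<xi>' = v' @- \<zeta>"
        proof
          assume "\<exists>\<zeta>. stream_act G \<phi> h \<xi>' = v' @- \<zeta>"
          then obtain \<zeta> where "stream_act G \<phi> h \<xi>' = v' @- \<zeta>" by blast
          then have "stream_act G \<phi> (inv h) (stream_act G \<phi> h \<xi>') = ?v @- stream_act G \<phi> (sect G \<phi> (inv h) v') \<zeta>"
            using gh by (simp add: stream_act_shift)
          then show False using False gh by (auto simp: stream_act_mult[symmetric])
        qed
        then have "\<nexists>\<zeta>. w @- stream_act G \<phi> h \<xi>' = v @- \<zeta>" by (auto simp: 2)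
        moreover have "\<nexists>\<zeta>. \<xi> = (z @ ?v) @- \<zeta>" using False by (auto simp: x)
        ultimately show ?thesis unfolding R unfolding st 2 is_mult2[OF gh]
          using partial_act_none by metis
      qed
    next
      case False
      then have "\<nexists>\<xi>'. \<xi> = (z @ \<phi> (inv h) v') @- \<xi>'" by auto
      then have "partial_act G \<phi> (Elem u g (z @ \<phi> (inv h) v')) \<xi> = None" for u g by (rule partial_act_none)
      moreover have "partial_act G \<phi> (Elem u g z) \<xi> = None" for u g using False by (rule partial_act_none)
      ultimately show ?thesis unfolding st 2 is_mult2[OF gh] by (simp only: option.case)
    qed
  next
    case 3
    have "\<nexists>\<zeta>. w @- \<xi>' = v @- \<zeta>" for \<xi>'
    proof
      assume "\<exists>\<zeta>. w @- \<xi>' = v @- \<zeta>"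
      then obtain \<zeta> where e: "w @- \<xi>' = v @- \<zeta>" by blast
      let ?n = "max (length w) (length v)"
      have "prefix w (stake ?n (w @- \<xi>'))" "prefix v (stake ?n (v @- \<zeta>))"
        by (auto simp: stake_shift prefix_def)
      with e 3 show False by (metis prefix_same_cases)
    qed
    then have "(case partial_act G \<phi> t \<xi> of None \<Rightarrow> None | Some \<eta> \<Rightarrow> partial_act G \<phi> s \<eta>) = None"
      by (auto simp: st shift_eq split: if_splits)
    then show ?thesis unfolding st is_mult3[OF 3] by simp
  qed
qed (auto split: option.splits)

lemma shift_sub:
  fixes u v :: "'x list"
  assumes "\<And>w. \<exists>w'. u @- w = v @- w'"
  shows "prefix v u"
proof (rule ccontr)
  assume n: "\<not> prefix v u"
  have pre: "prefix u v"
  proof -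
    obtain w' where e: "u @- undefined = v @- w'" using assms by blast
    let ?n = "max (length u) (length v)"
    have "prefix u (stake ?n (u @- undefined))" "prefix v (stake ?n (v @- w'))"
      by (auto simp: stake_shift prefix_def)
    with e n show ?thesis by (metis prefix_same_cases)
  qed
  with n obtain x p where v: "v = u @ x # p" unfolding prefix_def by (metis append_Nil2 neq_Nil_conv)
  obtain y where "y \<noteq> x"
  proof -
    have "card (UNIV :: 'x set) \<noteq> card {x}" using card_alphabet by simp
    then have "UNIV \<noteq> {x}" by metis
    then show ?thesis using that by blast
  qed
  then show False using assms[of "y ## undefined"] by (auto simp: v dest!: arg_cong[where f = "sdrop (length u)"])
qed

lemma partial_act_inj:
  assumes "s \<in> carrier IS" "t \<in> carrier IS" "\<And>w. partial_act G \<phi> s w = partial_act G \<phi> t w"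
  shows "s = t"
proof (cases s; cases t)
  fix u g v u' g' v' assume st: "s = Elem u g v" "t = Elem u' g' v'"
  then have gh: "g \<in> carrier G" "g' \<in> carrier G" using assms by (auto simp: inv_semigroup_def)
  have eq: "partial_act G \<phi> (Elem u g v) w = partial_act G \<phi> (Elem u' g' v') w" for w
    using assms(3) by (simp only: st)
  have "\<exists>w'. v @- w = v' @- w'" for w
    using eq[of "v @- w"] partial_act_none[of "v @- w" v' u' g'] unfolding partial_act_shift by (metis option.distinct(1))
  moreover have "\<exists>w'. v' @- w = v @- w'" for w
    using eq[of "v' @- w"] partial_act_none[of "v' @- w" v u g] unfolding partial_act_shift by (metis option.distinct(1))
  ultimately have v: "v = v'" using shift_sub by (metis prefix_order.antisym)
  have eq2: "u @- stream_act G \<phi> g w = u' @- stream_act G \<phi> g' w" for w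
    using eq[of "v @- w"] unfolding v partial_act_shift by simp
  have "\<exists>w'. u @- w = u' @- w'" for w
    using eq2[of "stream_act G \<phi> (inv g) w"] gh by (auto simp: stream_act_mult[symmetric])
  moreover have "\<exists>w'. u' @- w = u @- w'" for w
    using eq2[of "stream_act G \<phi> (inv g') w"] gh by (metis Gr.inv_closed Gr.r_inv stream_act_mult stream_act_one)
  ultimately have u: "u = u'" using shift_sub by (metis prefix_order.antisym)
  have "stream_act G \<phi> g w = stream_act G \<phi> g' w" for w
    using eq2[of w] unfolding u by (metis sdrop_shift drop_all order_refl diff_self_eq_0 shift.simps(1) sdrop.simps(1))
  then have "\<phi> g (stake n w) = \<phi> g' (stake n w)" for n w
    using gh by (metis stake_stream_act)
  then have "\<phi> g w = \<phi> g' w" for w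
    using shift_eq[of w "w @- undefined"] by metis
  then have "g = g'" by (rule act_eqI[OF gh])
  with u v st show ?thesis by simp
next
  fix u g v assume st: "s = Zero" "t = Elem u g v"
  show ?thesis using assms(3)[of "v @- undefined"] unfolding st partial_act_shift by simp
next
  fix u g v assume st: "s = Elem u g v" "t = Zero"
  show ?thesis using assms(3)[of "v @- undefined"] unfolding st partial_act_shift by simp
qed simp

lemma is_mult_assoc:
  assumes "s \<in> carrier IS" "t \<in> carrier IS" "r \<in> carrier IS"
  shows "is_mult G \<phi> (is_mult G \<phi> s t) r = is_mult G \<phi> s (is_mult G \<phi> t r)"
  by (rule partial_act_inj)
    (use assms in \<open>auto simp: partial_act_mult is_mult_closed simp del: partial_act.simps is_mult.simps split: option.splits\<close>)

lemma is_mult_one: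
  assumes "s \<in> carrier IS"
  shows "is_mult G \<phi> (Elem [] \<one> []) s = s" "is_mult G \<phi> s (Elem [] \<one> []) = s"
proof -
  show "is_mult G \<phi> (Elem [] \<one> []) s = s"
    using assms by (cases s) (auto simp: inv_semigroup_def)
  show "is_mult G \<phi> s (Elem [] \<one> []) = s"
  proof (cases s)
    case (Elem u g v)
    then show ?thesis using is_mult2[of g \<one> u "[]" v "[]"] assms by (auto simp: inv_semigroup_def)
  qed simp
qed

sublocale IS: monoid_with_zero IS Zero
proof
  show "x \<otimes>\<^bsub>IS\<^esub> y \<otimes>\<^bsub>IS\<^esub> w = x \<otimes>\<^bsub>IS\<^esub> (y \<otimes>\<^bsub>IS\<^esub> w)"
    if "x \<in> carrier IS" "y \<in> carrier IS" "w \<in> carrier IS" for x y w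
    using is_mult_assoc[OF that] by (simp add: inv_semigroup_def)
  show "x \<otimes>\<^bsub>IS\<^esub> y \<in> carrier IS" if "x \<in> carrier IS" "y \<in> carrier IS" for x y
    using is_mult_closed[OF that] by (simp add: inv_semigroup_def)
  show "\<one>\<^bsub>IS\<^esub> \<otimes>\<^bsub>IS\<^esub> x = x" "x \<otimes>\<^bsub>IS\<^esub> \<one>\<^bsub>IS\<^esub> = x" if "x \<in> carrier IS" for x
    using is_mult_one[OF that] by (simp_all add: inv_semigroup_def)
qed (simp_all add: inv_semigroup_def)

lemma idempotents_IS: "idempotents IS = insert Zero {Elem w \<one> w | w. True}"
proof (intro equalityI subsetI)
  fix e assume "e \<in> idempotents IS"
  then have e: "e \<in> carrier IS" "is_mult G \<phi> e e = e" by (auto simp: idempotents_def inv_semigroup_def)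
  show "e \<in> insert Zero {Elem w \<one> w | w. True}"
  proof (cases e)
    case (Elem u g v)
    with e have g: "g \<in> carrier G" by (auto simp: inv_semigroup_def)
    consider (1) p where "u = v @ p" | (2) p where "v = u @ p" | (3) "\<not> prefix v u" "\<not> prefix u v"
      by (auto simp: prefix_def)
    then show ?thesis
    proof cases
      case 1
      have "p = []" "sect G \<phi> g p \<otimes> g = g"
        using e(2) g unfolding Elem 1 is_mult1 by (auto simp: length_preserving dest: arg_cong[where f=length])
      then show ?thesis using g 1 Elem by (simp add: Gr.l_cancel_one')
    next
      case 2
      have p: "\<phi> (inv g) p = []" "g \<otimes> sect G \<phi> g (\<phi> (inv g) p) = g"
        using e(2) unfolding Elem 2 is_mult2[OF g g] by auto
      then have "p = []" using g length_preserving[of "inv g" p] by simp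
      with p g have "g = \<one>" by (simp add: Gr.l_cancel_one')
      then show ?thesis using \<open>p = []\<close> 2 Elem by simp
    next
      case 3
      then show ?thesis using e(2) Elem by simp
    qed
  qed simp
qed (auto simp: idempotents_def inv_semigroup_def)

lemma idem_le_IS: "idem_le IS (Elem w \<one> w) (Elem u \<one> u) \<longleftrightarrow> prefix u w"
proof
  assume "idem_le IS (Elem w \<one> w) (Elem u \<one> u)"
  then have e: "is_mult G \<phi> (Elem w \<one> w) (Elem u \<one> u) = Elem w \<one> w" by (simp add: idem_le_def inv_semigroup_def)
  consider (1) p where "u = w @ p" | (2) p where "w = u @ p" | (3) "\<not> prefix w u" "\<not> prefix u w"
    by (auto simp: prefix_def)
  then show "prefix u w" using e by cases (auto split: if_splits)
next
  assume "prefix u w"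
  then obtain p where "w = u @ p" by (auto simp: prefix_def)
  then show "idem_le IS (Elem w \<one> w) (Elem u \<one> u)"
    using is_mult2[of \<one> \<one> w u p u] by (simp add: idem_le_def inv_semigroup_def)
qed

end

subsection \<open>The representation is a ring homomorphism that kills the Cuntz--Krieger generator\<close>

context self_similar_group
begin

definition pa :: "('x, 'g) iselem \<Rightarrow> 'x stream \<Rightarrow> 'k::field \<Rightarrow> 'x stream \<Rightarrow>\<^sub>0 'k" where
  "pa s w c = (case partial_act G \<phi> s w of None \<Rightarrow> 0 | Some w' \<Rightarrow> Poly_Mapping.single w' c)"

lemma pa_0 [simp]: "pa s w 0 = 0" by (simp add: pa_def split: option.split)
lemma pa_add: "pa s w (c + d) = pa s w c + pa s w d"
  by (simp add: pa_def single_add split: option.split)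

lemma rep_eq:
  assumes "finite A" "Poly_Mapping.keys a \<subseteq> A" "finite B" "Poly_Mapping.keys v \<subseteq> B"
  shows "stream_rep G \<phi> a v = (\<Sum>s\<in>A. \<Sum>w\<in>B. pa s w (Poly_Mapping.lookup a s * Poly_Mapping.lookup v w))"
proof -
  have "stream_rep G \<phi> a v = (\<Sum>s\<in>Poly_Mapping.keys a. \<Sum>w\<in>Poly_Mapping.keys v. pa s w (Poly_Mapping.lookup a s * Poly_Mapping.lookup v w))"
    by (simp add: stream_rep_def pa_def)
  also have "\<dots> = (\<Sum>s\<in>Poly_Mapping.keys a. \<Sum>w\<in>B. pa s w (Poly_Mapping.lookup a s * Poly_Mapping.lookup v w))"
    using assms by (intro sum.cong refl sum.mono_neutral_left) (auto simp: in_keys_iff)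
  also have "\<dots> = (\<Sum>s\<in>A. \<Sum>w\<in>B. pa s w (Poly_Mapping.lookup a s * Poly_Mapping.lookup v w))"
    using assms by (intro sum.mono_neutral_left) (auto simp: in_keys_iff)
  finally show ?thesis .
qed

lemma rep_add_left: "stream_rep G \<phi> (a + b) v = stream_rep G \<phi> a v + stream_rep G \<phi> b v"
proof -
  let ?A = "Poly_Mapping.keys a \<union> Poly_Mapping.keys b"
  have "Poly_Mapping.keys (a + b) \<subseteq> ?A" by (rule Poly_Mapping.keys_add)
  then show ?thesis
    by (subst (1 2 3) rep_eq[where A = ?A and B = "Poly_Mapping.keys v"])
      (auto simp: lookup_add distrib_right pa_add sum.distrib)
qed

lemma rep_add_right: "stream_rep G \<phi> a (v + w) = stream_rep G \<phi> a v + stream_rep G \<phi> a w"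
proof -
  let ?A = "Poly_Mapping.keys v \<union> Poly_Mapping.keys w"
  have "Poly_Mapping.keys (v + w) \<subseteq> ?A" by (rule Poly_Mapping.keys_add)
  then show ?thesis
    by (subst (1 2 3) rep_eq[where B = ?A and A = "Poly_Mapping.keys a"])
      (auto simp: lookup_add distrib_left pa_add sum.distrib)
qed

lemma rep_0 [simp]: "stream_rep G \<phi> 0 v = 0" "stream_rep G \<phi> a 0 = 0"
  by (simp_all add: stream_rep_def)

lemma rep_sum_left: "stream_rep G \<phi> (\<Sum>i\<in>I. f i) v = (\<Sum>i\<in>I. stream_rep G \<phi> (f i) v)"
  by (induction I rule: infinite_finite_induct) (auto simp: rep_add_left)

lemma rep_sum_right: "stream_rep G \<phi> a (\<Sum>i\<in>I. f i) = (\<Sum>i\<in>I. stream_rep G \<phi> a (f i))"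
  by (induction I rule: infinite_finite_induct) (auto simp: rep_add_right)

lemma rep_single: "stream_rep G \<phi> (Poly_Mapping.single s c) (Poly_Mapping.single w d) = pa s w (c * d)"
  by (subst rep_eq[where A="{s}" and B="{w}"]) auto

lemma rep_csingle: "stream_rep G \<phi> (csingle Zero s c) (Poly_Mapping.single w d) = pa s w (c * d)"
  by (cases s) (auto simp: csingle_def rep_single, simp add: pa_def)

lemma vscale_lookup [simp]: "Poly_Mapping.lookup (vscale c v) x = c * Poly_Mapping.lookup v x"
  by (simp add: vscale_def map.rep_eq when_def)

lemma vector_space_vscale: "vector_space (vscale :: 'k::field \<Rightarrow> ('b \<Rightarrow>\<^sub>0 'k) \<Rightarrow> _)"
  by unfold_locales (auto intro!: poly_mapping_eqI simp: lookup_add algebra_simps)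

lemma vscale_sum: "vscale c (\<Sum>i\<in>I. f i) = (\<Sum>i\<in>I. vscale c (f i))"
  by (intro poly_mapping_eqI) (simp add: lookup_sum sum_distrib_left)

lemma vscale_pa: "vscale c (pa s w d) = pa s w (c * d)"
  by (auto intro!: poly_mapping_eqI simp: pa_def lookup_single when_def split: option.split)

lemma rep_vscale: "stream_rep G \<phi> a (vscale c v) = vscale c (stream_rep G \<phi> a v)"
proof -
  have "Poly_Mapping.keys (vscale c v) \<subseteq> Poly_Mapping.keys v" by (auto simp: in_keys_iff)
  then show ?thesis
    by (subst (1 2) rep_eq[where A = "Poly_Mapping.keys a" and B = "Poly_Mapping.keys v"])
      (auto simp: vscale_sum vscale_pa mult.left_commute)
qed

lemma rep_linear: "stream_rep G \<phi> a \<in> carrier End_ring"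
  by (simp add: End_ring_def Vector_Spaces.linear_iff vector_space_vscale rep_add_right rep_vscale)

lemma rep_pa: "stream_rep G \<phi> (csingle Zero s c) (pa t w d) =
   (case partial_act G \<phi> t w of None \<Rightarrow> 0 | Some w' \<Rightarrow> pa s w' (c * d))"
  by (auto simp: pa_def[of t] rep_csingle split: option.split)

lemma rep_mult:
  assumes "Poly_Mapping.keys a \<subseteq> carrier IS - {Zero}" "Poly_Mapping.keys b \<subseteq> carrier IS - {Zero}"
  shows "stream_rep G \<phi> (IS.cm a b) v = stream_rep G \<phi> a (stream_rep G \<phi> b v)"
proof -
  define A where "A = Poly_Mapping.keys a"
  define B where "B = Poly_Mapping.keys b"
  define C where "C = Poly_Mapping.keys v"
  have sub: "A \<subseteq> carrier IS" "B \<subseteq> carrier IS"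
    using assms by (auto simp: A_def B_def)
  define sa where "sa = (\<lambda>s. csingle Zero s (Poly_Mapping.lookup a s))"
  define sb where "sb = (\<lambda>s. csingle Zero s (Poly_Mapping.lookup b s))"
  define sc where "sc = (\<lambda>s. Poly_Mapping.single s (Poly_Mapping.lookup v s))"
  have eqs: "a = sum sa A" "b = sum sb B" "v = sum sc C"
    using assms by (simp_all add: IS.sum_csingle_self sum_single_self A_def B_def C_def sa_def sb_def sc_def)
  have "stream_rep G \<phi> (IS.cm (sa i) (sb j)) (sc k) = stream_rep G \<phi> (sa i) (stream_rep G \<phi> (sb j) (sc k))"
    if "i \<in> A" "j \<in> B" "k \<in> C" for i j k
  proof -
    have ij: "i \<in> carrier IS" "j \<in> carrier IS" using that sub by auto
    have m: "i \<otimes>\<^bsub>IS\<^esub> j = is_mult G \<phi> i j" by (simp add: inv_semigroup_def)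
    show ?thesis
      unfolding sa_def sb_def sc_def IS.cm_csingle[OF ij] rep_csingle rep_pa m
      unfolding pa_def partial_act_mult[OF ij] by (auto split: option.split simp: mult.assoc)
  qed
  then show ?thesis
    unfolding eqs IS.cm_sum_left IS.cm_sum_right rep_sum_left rep_sum_right by (intro sum.cong refl)
qed

lemma rep_one: "stream_rep G \<phi> (csingle Zero (Elem [] \<one> []) 1) v = v"
proof -
  have "stream_rep G \<phi> (csingle Zero (Elem [] \<one> []) 1) (\<Sum>w\<in>Poly_Mapping.keys v. Poly_Mapping.single w (Poly_Mapping.lookup v w))
     = (\<Sum>w\<in>Poly_Mapping.keys v. Poly_Mapping.single w (Poly_Mapping.lookup v w))"
    unfolding rep_sum_right rep_csingle pa_def by simp
  then show ?thesis by (simp add: sum_single_self)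
qed

lemma rep_ring_hom: "stream_rep G \<phi> \<in> ring_hom (K0S G \<phi> :: (('x,'g) iselem \<Rightarrow>\<^sub>0 'k::field) ring) End_ring"
proof (rule ring_hom_memI)
  fix a b :: "('x,'g) iselem \<Rightarrow>\<^sub>0 'k" assume "a \<in> carrier (K0S G \<phi>)" "b \<in> carrier (K0S G \<phi>)"
  then have k: "Poly_Mapping.keys a \<subseteq> carrier IS - {Zero}" "Poly_Mapping.keys b \<subseteq> carrier IS - {Zero}"
    by (simp_all add: contracted_algebra_def)
  show "stream_rep G \<phi> (a \<otimes>\<^bsub>K0S G \<phi>\<^esub> b) = stream_rep G \<phi> a \<otimes>\<^bsub>End_ring\<^esub> stream_rep G \<phi> b"
    using rep_mult[OF k] by (auto simp: IS.cm_def End_ring_def)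
  show "stream_rep G \<phi> (a \<oplus>\<^bsub>K0S G \<phi>\<^esub> b) = stream_rep G \<phi> a \<oplus>\<^bsub>End_ring\<^esub> stream_rep G \<phi> b"
    by (auto simp: End_ring_def contracted_algebra_def rep_add_left)
next
  have "one IS = Elem [] \<one> []" by (simp add: inv_semigroup_def)
  then show "stream_rep G \<phi> \<one>\<^bsub>K0S G \<phi> :: (('x,'g) iselem \<Rightarrow>\<^sub>0 'k::field) ring\<^esub> = \<one>\<^bsub>End_ring\<^esub>"
    by (auto simp: contracted_algebra_def End_ring_def rep_one)
qed (rule rep_linear)

lemma ck_generator: "stream_rep G \<phi> (\<one>\<^bsub>K0S G \<phi>\<^esub> - (\<Sum>x\<in>UNIV. Poly_Mapping.single (Elem [x] \<one> [x]) 1)) v = (0 :: _ \<Rightarrow>\<^sub>0 'k::field)"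
proof -
  let ?c = "(\<Sum>x\<in>UNIV. Poly_Mapping.single (Elem [x] \<one> [x]) 1) :: ('x,'g) iselem \<Rightarrow>\<^sub>0 'k"
  have o: "one IS = Elem [] \<one> []" by (simp add: inv_semigroup_def)
  have "stream_rep G \<phi> ?c (\<Sum>w\<in>Poly_Mapping.keys v. Poly_Mapping.single w (Poly_Mapping.lookup v w)) =
     (\<Sum>w\<in>Poly_Mapping.keys v. Poly_Mapping.single w (Poly_Mapping.lookup v w))"
    unfolding rep_sum_right
  proof (intro sum.cong refl)
    fix w
    have "stream_rep G \<phi> ?c (Poly_Mapping.single w (Poly_Mapping.lookup v w)) =
      (\<Sum>x\<in>UNIV. if shd w = x then Poly_Mapping.single w (Poly_Mapping.lookup v w) else 0)"
      unfolding rep_sum_left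
      by (intro sum.cong refl) (auto simp: rep_single pa_def)
    then show "stream_rep G \<phi> ?c (Poly_Mapping.single w (Poly_Mapping.lookup v w)) = Poly_Mapping.single w (Poly_Mapping.lookup v w)"
      by simp
  qed
  then have c: "stream_rep G \<phi> ?c v = v" by (simp add: sum_single_self)
  have "stream_rep G \<phi> ((\<one>\<^bsub>K0S G \<phi>\<^esub> - ?c) + ?c) v = v"
    by (simp add: contracted_algebra_def o rep_one)
  then show ?thesis unfolding rep_add_left c by simp
qed

end

end

theory Submission
  imports Defs
begin

text \<open>
The whole statement follows from two facts about an element \<open>a\<close> of \<open>K\<^sub>0S\<close>. Write \<open>I\<close> for the
singular ideal, and identify an element of \<open>S\<close> with the partial map of \<open>X\<^sup>\<omega>\<close> that it defines; this
loses no information because the action is faithful and \<open>X\<close> has at least two letters.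

(1) If \<open>a \<in> I\<close>, then \<open>a\<close> acts as zero. Partial maps in \<open>S\<close> are continuous on \<open>X\<^sup>\<omega>\<close>, so the total coefficient
that \<open>a \<cdot> \<xi>\<close> gives to a cylinder is locally constant in \<open>\<xi>\<close>, and singularity makes \<open>a \<cdot> \<xi>\<close> vanish
for a dense set of \<open>\<xi>\<close> (\<open>singular_acts_trivially\<close>).

(2) If \<open>a \<notin> I\<close>, then \<open>x a y = 1\<close> for some \<open>x\<close> and \<open>y\<close>. On a sufficiently small cylinder any two of the
finitely many terms of \<open>a\<close> either coincide or have different values at every point. Since \<open>a \<notin> I\<close>, the
cylinder can be chosen so that the terms do not cancel on it; then multiplying by idempotents from
both sides isolates a single nonzero term (\<open>nonsingular_generates_one\<close>).

By (2), every ideal that is not contained in \<open>I\<close> is the whole algebra. The kernel of the representation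
is a proper ideal, so it is contained in \<open>I\<close>, and by (1) it equals \<open>I\<close>. In particular \<open>I\<close> is an ideal,
and it is the largest proper one.

The tight ideal is the Cuntz--Krieger ideal: \<open>1 - \<Sum>xx\<^sup>*\<close> is itself a cover product, and
conversely, modulo \<open>1 - \<Sum>xx\<^sup>*\<close>, every idempotent \<open>e\<close> is a sum of idempotents of arbitrarily long words,
which are annihilated by a cover product for \<open>e\<close> once they are longer than the words of the cover
(\<open>tight_eq_cuntz_krieger\<close>). The tight ideal \<open>\<T>\<close> is contained in the kernel \<open>I\<close>, so \<open>I / \<T>\<close> is the
kernel of the induced representation and the largest proper ideal of the Nekrashevych algebra. Hence
simplicity and faithfulness both mean \<open>I = \<T>\<close>.
\<close>

section \<open>Partial maps near an infinite word\<close>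

lemma stake_eq_mono: "stake n s = stake n t \<Longrightarrow> m \<le> n \<Longrightarrow> stake m s = stake m t"
  by (metis min.absorb1 take_stake)

context self_similar_group
begin

abbreviation cyl :: "'x list \<Rightarrow> ('x, 'g) iselem" where
  "cyl w \<equiv> Elem w \<one> w"

lemma cyl_closed: "cyl w \<in> carrier IS"
  by (simp add: inv_semigroup_def)

lemma partial_act_cyl:
  "partial_act G \<phi> (cyl w) \<xi> = (if stake (length w) \<xi> = w then Some \<xi> else None)"
  using stake_sdrop[of "length w" \<xi>] by auto

lemma mult_IS: "s \<otimes>\<^bsub>IS\<^esub> t = is_mult G \<phi> s t"
  by (simp add: inv_semigroup_def)

lemma partial_act_times:
  "s \<in> carrier IS \<Longrightarrow> t \<in> carrier IS \<Longrightarrow> partial_act G \<phi> (s \<otimes>\<^bsub>IS\<^esub> t) \<xi> =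
     Option.bind (partial_act G \<phi> t \<xi>) (partial_act G \<phi> s)"
  by (simp add: mult_IS partial_act_mult Option.bind_eq_Some_conv split: option.split del: is_mult.simps partial_act.simps)

text \<open>
Elements of \<open>G\<close> send the first letters of an infinite word to the first letters of its image. The value
\<open>None\<close> is treated as an isolated point, since the domain is a cylinder and membership in it
is also decided by a prefix.
\<close>

lemma partial_act_locally_constant:
  assumes s: "s \<in> carrier IS"
  shows "\<exists>n. \<forall>\<xi>'. stake n \<xi>' = stake n \<xi> \<longrightarrow>
    map_option (stake m) (partial_act G \<phi> s \<xi>') = map_option (stake m) (partial_act G \<phi> s \<xi>)"
proof (cases s)
  case (Elem u g v)
  with s have g: "g \<in> carrier G" by (auto simp: inv_semigroup_def)
  show ?thesis
  proof (intro exI[of _ "length v + m"] allI impI)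
    fix \<xi>' assume e: "stake (length v + m) \<xi>' = stake (length v + m) \<xi>"
    have v: "stake (length v) \<xi>' = stake (length v) \<xi>"
      using e by (rule stake_eq_mono) simp
    have "stake m (sdrop (length v) \<xi>') = stake m (sdrop (length v) \<xi>)"
      using e by (metis drop_stake diff_add_inverse)
    then have "stake k (stream_act G \<phi> g (sdrop (length v) \<xi>')) = stake k (stream_act G \<phi> g (sdrop (length v) \<xi>))"
      if "k \<le> m" for k
      unfolding stake_stream_act[OF g] using stake_eq_mono[OF _ that] by metis
    then show "map_option (stake m) (partial_act G \<phi> s \<xi>') = map_option (stake m) (partial_act G \<phi> s \<xi>)"
      unfolding Elem using v by (simp add: stake_shift)
  qed
qed simp

lemma partial_acts_locally_constant:
  assumes "finite A" "A \<subseteq> carrier IS"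
  shows "\<exists>n\<ge>k. \<forall>s\<in>A. \<forall>\<xi>'. stake n \<xi>' = stake n \<xi> \<longrightarrow>
    map_option (stake m) (partial_act G \<phi> s \<xi>') = map_option (stake m) (partial_act G \<phi> s \<xi>)"
  using assms
proof (induction A)
  case (insert s A)
  then obtain n where n: "n \<ge> k" "\<And>t \<xi>'. t \<in> A \<Longrightarrow> stake n \<xi>' = stake n \<xi> \<Longrightarrow>
    map_option (stake m) (partial_act G \<phi> t \<xi>') = map_option (stake m) (partial_act G \<phi> t \<xi>)"
    by auto
  obtain n' where n': "\<And>\<xi>'. stake n' \<xi>' = stake n' \<xi> \<Longrightarrow>
    map_option (stake m) (partial_act G \<phi> s \<xi>') = map_option (stake m) (partial_act G \<phi> s \<xi>)"
    using partial_act_locally_constant[of s \<xi> m] insert.prems by auto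
  show ?case
  proof (intro exI[of _ "max n n'"] conjI ballI allI impI)
    fix t \<xi>' assume "t \<in> insert s A" and e: "stake (max n n') \<xi>' = stake (max n n') \<xi>"
    moreover have "stake n \<xi>' = stake n \<xi>" "stake n' \<xi>' = stake n' \<xi>"
      using e by (auto intro: stake_eq_mono[OF e])
    ultimately show "map_option (stake m) (partial_act G \<phi> t \<xi>') = map_option (stake m) (partial_act G \<phi> t \<xi>)"
      using n(2) n' by blast
  qed (use n(1) in simp)
qed auto

text \<open>
The finitely many values \<open>s(\<xi>)\<close> that differ from \<open>\<eta>\<close> already differ from it in a common prefix length.
\<close>

lemma stake_distinguishes_values:
  assumes "finite A"
  shows "\<exists>m. \<forall>s\<in>A. map_option (stake m) (partial_act G \<phi> s \<xi>) = Some (stake m \<eta>) \<longleftrightarrow>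
    partial_act G \<phi> s \<xi> = Some \<eta>"
  using assms
proof (induction A)
  case (insert s A)
  then obtain m where m: "\<And>t. t \<in> A \<Longrightarrow>
      map_option (stake m) (partial_act G \<phi> t \<xi>) = Some (stake m \<eta>) \<longleftrightarrow> partial_act G \<phi> t \<xi> = Some \<eta>"
    by auto
  obtain m' where m': "map_option (stake m') (partial_act G \<phi> s \<xi>) = Some (stake m' \<eta>) \<longrightarrow> partial_act G \<phi> s \<xi> = Some \<eta>"
    using stream_eqI[of _ \<eta>] by (cases "partial_act G \<phi> s \<xi>") auto
  show ?case
  proof (intro exI[of _ "max m m'"] ballI)
    fix t assume "t \<in> insert s A"
    then show "map_option (stake (max m m')) (partial_act G \<phi> t \<xi>) = Some (stake (max m m') \<eta>) \<longleftrightarrow>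
      partial_act G \<phi> t \<xi> = Some \<eta>"
      using m[of t] m' by (auto dest: stake_eq_mono[of "max m m'" _ _ m] stake_eq_mono[of "max m m'" _ _ m'])
  qed
qed auto

text \<open>
The two uniformity statements combined: whether \<open>s(\<xi>) = \<eta>\<close> holds can be tested on prefixes, and the
test has the same outcome at every \<open>\<xi>'\<close> near \<open>\<xi>\<close>. This replaces the exact condition, which is
sensitive to moving \<open>\<xi>\<close>, by a locally constant one. The bound \<open>k\<close> lets the neighbourhood
of \<open>\<xi>\<close> be chosen inside a given cylinder.
\<close>

lemma values_isolated:
  assumes "finite A" "A \<subseteq> carrier IS"
  obtains m n where "k \<le> n"
    "\<And>s \<xi>'. s \<in> A \<Longrightarrow> stake n \<xi>' = stake n \<xi> \<Longrightarrow>
      map_option (stake m) (partial_act G \<phi> s \<xi>') = Some (stake m \<eta>) \<longleftrightarrow> partial_act G \<phi> s \<xi> = Some \<eta>"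
proof -
  obtain m where m: "\<And>s. s \<in> A \<Longrightarrow>
      map_option (stake m) (partial_act G \<phi> s \<xi>) = Some (stake m \<eta>) \<longleftrightarrow> partial_act G \<phi> s \<xi> = Some \<eta>"
    using stake_distinguishes_values[OF assms(1), of \<xi> \<eta>] by auto
  obtain n where "k \<le> n" and n: "\<And>s \<xi>'. s \<in> A \<Longrightarrow> stake n \<xi>' = stake n \<xi> \<Longrightarrow>
      map_option (stake m) (partial_act G \<phi> s \<xi>') = map_option (stake m) (partial_act G \<phi> s \<xi>)"
    using partial_acts_locally_constant[OF assms, of k \<xi> m] by auto
  show ?thesis
    by (rule that[OF \<open>k \<le> n\<close>, of m]) (subst n, assumption, assumption, erule m)
qed

text \<open>
For separated maps, a common value at one point of the cylinder forces equality on all of it. Being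
undefined counts as a value: two maps whose domains miss the cylinder agree on it.
\<close>

definition separated :: "'x list \<Rightarrow> ('x, 'g) iselem \<Rightarrow> ('x, 'g) iselem \<Rightarrow> bool" where
  "separated v s t \<longleftrightarrow>
    (\<forall>\<xi>. partial_act G \<phi> s (v @- \<xi>) = partial_act G \<phi> t (v @- \<xi>)) \<or>
    (\<forall>\<xi>. partial_act G \<phi> s (v @- \<xi>) \<noteq> partial_act G \<phi> t (v @- \<xi>))"

lemma separated_append: "separated v s t \<Longrightarrow> separated (v @ w) s t"
  by (auto simp: separated_def)

text \<open>
If the two maps differ at a single point of the cylinder, then they differ in a finite prefix
there, hence on a whole smaller cylinder by local constancy.
\<close>

lemma separated_extension:
  assumes st: "s \<in> carrier IS" "t \<in> carrier IS"
  shows "\<exists>w. separated (v @ w) s t"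
proof (cases "\<forall>\<xi>. partial_act G \<phi> s (v @- \<xi>) = partial_act G \<phi> t (v @- \<xi>)")
  case True
  then show ?thesis by (intro exI[of _ "[]"]) (simp add: separated_def)
next
  case False
  then obtain \<xi> where ne: "partial_act G \<phi> s (v @- \<xi>) \<noteq> partial_act G \<phi> t (v @- \<xi>)" by blast
  obtain m where m: "map_option (stake m) (partial_act G \<phi> s (v @- \<xi>)) \<noteq> map_option (stake m) (partial_act G \<phi> t (v @- \<xi>))"
    using ne stream_eqI
    by (cases "partial_act G \<phi> s (v @- \<xi>)"; cases "partial_act G \<phi> t (v @- \<xi>)") (auto simp del: partial_act.simps, blast)
  obtain n where n: "n \<ge> length v" "\<And>r \<xi>'. r \<in> {s, t} \<Longrightarrow> stake n \<xi>' = stake n (v @- \<xi>) \<Longrightarrow>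
      map_option (stake m) (partial_act G \<phi> r \<xi>') = map_option (stake m) (partial_act G \<phi> r (v @- \<xi>))"
    using partial_acts_locally_constant[of "{s, t}" "length v" "v @- \<xi>" m] st by auto
  define w where "w = stake (n - length v) \<xi>"
  have "v @ w = stake n (v @- \<xi>)" using n(1) by (simp add: w_def stake_shift)
  then have "stake n ((v @ w) @- \<zeta>) = stake n (v @- \<xi>)" for \<zeta>
    by (metis length_stake stake_shift diff_self_eq_0 stake.simps(1) append_Nil2 take_all order_refl)
  then have "separated (v @ w) s t"
    using n(2)[of s] n(2)[of t] m unfolding separated_def by (metis insertCI)
  then show ?thesis by blast
qed

text \<open>
Separation survives shrinking of the cylinder, so finitely many pairs can be handled one by one.
\<close>

lemma all_separated_extension:
  assumes "finite P" "P \<subseteq> carrier IS \<times> carrier IS"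
  shows "\<exists>w. \<forall>(s, t)\<in>P. separated (v @ w) s t"
  using assms
proof (induction P)
  case (insert p P)
  then obtain w where w: "\<forall>(s, t)\<in>P. separated (v @ w) s t" by auto
  obtain s t where p: "p = (s, t)" by force
  obtain w' where "separated ((v @ w) @ w') s t"
    using separated_extension[of s t "v @ w"] insert.prems p by auto
  moreover have "\<forall>(s, t)\<in>P. separated ((v @ w) @ w') s t"
    using w separated_append by blast
  ultimately show ?case
    using p by (intro exI[of _ "w @ w'"]) simp
qed auto

end

section \<open>The singular ideal is the kernel and the largest proper ideal\<close>

lemma csingle_sum: "csingle z s (\<Sum>i\<in>I. f i) = (\<Sum>i\<in>I. csingle z s (f i))"
  by (induction I rule: infinite_finite_induct) (auto simp: csingle_add)

context monoid_with_zero
begin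

lemma mult_contracted_algebra: "mult (contracted_algebra S z) a b = cm a b"
  by (simp add: cm_def)

lemma cm_csingle_right:
  assumes "Poly_Mapping.keys a \<subseteq> carrier S - {z}" "t \<in> carrier S"
  shows "cm a (csingle z t 1) = (\<Sum>s\<in>Poly_Mapping.keys a. csingle z (s \<otimes> t) (Poly_Mapping.lookup a s))"
proof -
  have "cm (\<Sum>s\<in>Poly_Mapping.keys a. csingle z s (Poly_Mapping.lookup a s)) (csingle z t 1) =
      (\<Sum>s\<in>Poly_Mapping.keys a. csingle z (s \<otimes> t) (Poly_Mapping.lookup a s))"
    unfolding cm_sum_left using assms by (intro sum.cong refl) (subst cm_csingle, auto)
  then show ?thesis using assms by (simp add: sum_csingle_self)
qed

lemma cm_sandwich:
  assumes "Poly_Mapping.keys a \<subseteq> carrier S - {z}" "s \<in> carrier S" "t \<in> carrier S"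
  shows "cm (cm (csingle z s 1) a) (csingle z t 1) =
    (\<Sum>r\<in>Poly_Mapping.keys a. csingle z (s \<otimes> r \<otimes> t) (Poly_Mapping.lookup a r))"
proof -
  have "cm (cm (csingle z s 1) (\<Sum>r\<in>Poly_Mapping.keys a. csingle z r (Poly_Mapping.lookup a r))) (csingle z t 1) =
      (\<Sum>r\<in>Poly_Mapping.keys a. csingle z (s \<otimes> r \<otimes> t) (Poly_Mapping.lookup a r))"
    unfolding cm_sum_left cm_sum_right
  proof (intro sum.cong refl)
    fix r assume "r \<in> Poly_Mapping.keys a"
    then have "r \<in> carrier S" using assms by auto
    then show "cm (cm (csingle z s 1) (csingle z r (Poly_Mapping.lookup a r))) (csingle z t 1) =
        csingle z (s \<otimes> r \<otimes> t) (Poly_Mapping.lookup a r)"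
      using assms by (simp add: cm_csingle)
  qed
  then show ?thesis using assms by (simp add: sum_csingle_self)
qed

lemma lookup_cm_csingle_right:
  assumes "Poly_Mapping.keys a \<subseteq> carrier S - {z}" "t \<in> carrier S" "r \<noteq> z"
  shows "Poly_Mapping.lookup (cm a (csingle z t 1)) r =
    (\<Sum>s\<in>{s \<in> Poly_Mapping.keys a. s \<otimes> t = r}. Poly_Mapping.lookup a s)"
proof -
  have "Poly_Mapping.lookup (cm a (csingle z t 1)) r =
      (\<Sum>s\<in>Poly_Mapping.keys a. if s \<otimes> t = r then Poly_Mapping.lookup a s else 0)"
    unfolding cm_csingle_right[OF assms(1,2)] lookup_sum
    using assms(3) by (intro sum.cong refl) (auto simp: csingle_def lookup_single)
  then show ?thesis by (simp add: sum.inter_filter)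
qed

end

context self_similar_group
begin

lemma mem_K0S: "a \<in> carrier (K0S G \<phi>) \<longleftrightarrow> Poly_Mapping.keys a \<subseteq> carrier IS - {Zero}"
  by (simp add: contracted_algebra_def)

lemma csingle_mem: "s \<in> carrier IS \<Longrightarrow> csingle Zero s c \<in> carrier (K0S G \<phi>)"
  unfolding mem_K0S by (rule IS.csingle_in)

lemma lookup_rep_single:
  "Poly_Mapping.lookup (stream_rep G \<phi> a (Poly_Mapping.single \<xi> 1)) \<eta> =
    (\<Sum>s\<in>{s \<in> Poly_Mapping.keys a. partial_act G \<phi> s \<xi> = Some \<eta>}. Poly_Mapping.lookup a s)"
proof -
  have "Poly_Mapping.lookup (stream_rep G \<phi> a (Poly_Mapping.single \<xi> 1)) \<eta> =
      (\<Sum>s\<in>Poly_Mapping.keys a. if partial_act G \<phi> s \<xi> = Some \<eta> then Poly_Mapping.lookup a s else 0)"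
    unfolding rep_eq[OF finite_keys subset_refl finite_keys subset_refl] lookup_sum
    by (intro sum.cong refl) (auto simp: pa_def lookup_single split: option.split)
  then show ?thesis by (simp add: sum.inter_filter)
qed

lemma rep_eq_zeroI:
  fixes a :: "('x, 'g) iselem \<Rightarrow>\<^sub>0 'k::field"
  assumes "\<And>\<xi>. stream_rep G \<phi> a (Poly_Mapping.single \<xi> 1) = 0"
  shows "stream_rep G \<phi> a = (\<lambda>_. 0)"
proof
  fix v :: "'x stream \<Rightarrow>\<^sub>0 'k"
  have "stream_rep G \<phi> a (Poly_Mapping.single \<xi> c) = 0" for \<xi> c
  proof -
    have "Poly_Mapping.single \<xi> c = vscale c (Poly_Mapping.single \<xi> (1::'k))"
      by (rule poly_mapping_eqI) (simp add: lookup_single when_def)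
    then have "stream_rep G \<phi> a (Poly_Mapping.single \<xi> c) = vscale c 0"
      by (simp only: rep_vscale assms)
    then show ?thesis by (simp add: poly_mapping_eqI)
  qed
  then have "stream_rep G \<phi> a (\<Sum>\<xi>\<in>Poly_Mapping.keys v. Poly_Mapping.single \<xi> (Poly_Mapping.lookup v \<xi>)) = 0"
    by (simp add: rep_sum_right)
  then show "stream_rep G \<phi> a v = 0" by (simp add: sum_single_self)
qed

text \<open>
The nonzero idempotents below \<open>vv\<^sup>*\<close> are indexed by the extensions of \<open>v\<close>.
\<close>

lemma singular_ideal_iff:
  "a \<in> singular_ideal IS Zero \<longleftrightarrow> a \<in> carrier (K0S G \<phi>) \<and>
    (\<forall>v. \<exists>w. IS.cm a (csingle Zero (cyl (v @ w)) 1) = 0)"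
proof -
  have "(\<exists>f\<in>idempotents IS. f \<noteq> Zero \<and> idem_le IS f (cyl v) \<and> P f) \<longleftrightarrow> (\<exists>w. P (cyl (v @ w)))" for P v
  proof
    assume "\<exists>f\<in>idempotents IS. f \<noteq> Zero \<and> idem_le IS f (cyl v) \<and> P f"
    then obtain u where "idem_le IS (cyl u) (cyl v)" "P (cyl u)" by (auto simp: idempotents_IS)
    then show "\<exists>w. P (cyl (v @ w))" unfolding idem_le_IS prefix_def by blast
  next
    assume "\<exists>w. P (cyl (v @ w))"
    then obtain w where "P (cyl (v @ w))" ..
    then show "\<exists>f\<in>idempotents IS. f \<noteq> Zero \<and> idem_le IS f (cyl v) \<and> P f"
      by (intro bexI[of _ "cyl (v @ w)"]) (auto simp: idempotents_IS idem_le_IS)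
  qed
  moreover have "(\<forall>e\<in>idempotents IS. e \<noteq> Zero \<longrightarrow> Q e) \<longleftrightarrow> (\<forall>v. Q (cyl v))" for Q
    by (auto simp: idempotents_IS)
  ultimately show ?thesis
    by (simp add: singular_ideal_def IS.mult_contracted_algebra)
qed

text \<open>
The coefficient of \<open>\<eta>\<close> in \<open>a \<cdot> \<xi>\<close> need not be locally constant in \<open>\<xi>\<close>: terms that agree at \<open>\<xi>\<close> may
drift apart nearby. The sum of the coefficients of all words sharing a long prefix with \<open>\<eta>\<close>
is locally constant, and if the prefix is long enough this sum equals the coefficient of \<open>\<eta>\<close> at \<open>\<xi>\<close>.
Singularity provides points \<open>\<zeta>\<close> arbitrarily close to \<open>\<xi>\<close> with \<open>a \<cdot> \<zeta> = 0\<close>, where the sum vanishes.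
\<close>

lemma singular_acts_trivially:
  assumes "a \<in> singular_ideal IS Zero"
  shows "stream_rep G \<phi> a = (\<lambda>_. 0)"
proof (intro rep_eq_zeroI poly_mapping_eqI)
  fix \<xi> \<eta>
  let ?A = "Poly_Mapping.keys a" and ?act = "partial_act G \<phi>"
  have a: "?A \<subseteq> carrier IS - {Zero}" and sing: "\<And>v. \<exists>w. IS.cm a (csingle Zero (cyl (v @ w)) 1) = 0"
    using assms by (auto simp: singular_ideal_iff mem_K0S)
  have A: "?A \<subseteq> carrier IS" using a by auto
  obtain m n where "0 \<le> n" and iso: "\<And>s \<xi>'. s \<in> ?A \<Longrightarrow> stake n \<xi>' = stake n \<xi> \<Longrightarrow>
      map_option (stake m) (?act s \<xi>') = Some (stake m \<eta>) \<longleftrightarrow> ?act s \<xi> = Some \<eta>"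
    by (rule values_isolated[OF finite_keys A, where k = 0 and \<xi> = \<xi> and \<eta> = \<eta>], rule that, assumption)
  obtain w where w: "IS.cm a (csingle Zero (cyl (stake n \<xi> @ w)) 1) = 0"
    using sing by blast
  \<comment> \<open>Only the prefix of \<open>\<zeta>\<close> matters; the tail is arbitrary.\<close>
  define \<zeta> where "\<zeta> = (stake n \<xi> @ w) @- undefined"
  have "stream_rep G \<phi> a (stream_rep G \<phi> (csingle Zero (cyl (stake n \<xi> @ w)) 1) (Poly_Mapping.single \<zeta> 1)) = 0"
    using rep_mult[OF a IS.csingle_in[OF cyl_closed], symmetric] by (simp add: w)
  then have zero: "stream_rep G \<phi> a (Poly_Mapping.single \<zeta> 1) = 0"
    by (simp add: rep_csingle pa_def \<zeta>_def del: partial_act.simps shift_append)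
  let ?B = "{s \<in> ?A. ?act s \<xi> = Some \<eta>}"
  have B: "?B = {s \<in> ?A. map_option (stake m) (?act s \<zeta>) = Some (stake m \<eta>)}"
    using iso[of _ \<zeta>] by (auto simp: \<zeta>_def stake_shift)
  \<comment> \<open>The left-hand side is the coefficient at \<open>\<xi>\<close>; it is regrouped by the values at \<open>\<zeta>\<close>, all of which share a prefix with \<open>\<eta>\<close>.\<close>
  have "(\<Sum>s\<in>?B. Poly_Mapping.lookup a s) =
      (\<Sum>y\<in>(\<lambda>s. ?act s \<zeta>) ` ?B. \<Sum>s\<in>{s \<in> ?B. ?act s \<zeta> = y}. Poly_Mapping.lookup a s)"
    by (rule sum.group[symmetric]) auto
  also have "\<dots> = 0"
  proof (rule sum.neutral, rule ballI)
    fix y assume "y \<in> (\<lambda>s. ?act s \<zeta>) ` ?B"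
    then obtain \<eta>' where y: "y = Some \<eta>'" "stake m \<eta>' = stake m \<eta>" by (auto simp: B)
    have "{s \<in> ?B. ?act s \<zeta> = y} = {s \<in> ?A. ?act s \<zeta> = Some \<eta>'}" by (auto simp: B y)
    then show "(\<Sum>s\<in>{s \<in> ?B. ?act s \<zeta> = y}. Poly_Mapping.lookup a s) = 0"
      using lookup_rep_single[of a \<zeta> \<eta>'] zero by simp
  qed
  finally show "Poly_Mapping.lookup (stream_rep G \<phi> a (Poly_Mapping.single \<xi> 1)) \<eta> = Poly_Mapping.lookup 0 \<eta>"
    by (simp add: lookup_rep_single)
qed

lemma one_K0S: "\<one>\<^bsub>K0S G \<phi>\<^esub> = csingle Zero (cyl []) 1"
  by (simp add: contracted_algebra_def inv_semigroup_def)

text \<open>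
With \<open>s = ugv\<^sup>*\<close>, one has \<open>(g\<^sup>-\<^sup>1 u\<^sup>*) s v = 1\<close>.
\<close>

lemma unit_sandwich:
  assumes "s \<in> carrier IS" "s \<noteq> Zero"
  obtains p q where "p \<in> carrier IS" "q \<in> carrier IS" "p \<otimes>\<^bsub>IS\<^esub> s \<otimes>\<^bsub>IS\<^esub> q = cyl []"
proof -
  obtain u g v where s: "s = Elem u g v" "g \<in> carrier G" using assms by (auto simp: inv_semigroup_def)
  show ?thesis
    by (rule that[of "Elem [] (inv g) u" "Elem v \<one> []"]) (use s in \<open>simp_all add: inv_semigroup_def\<close>)
qed

text \<open>
Fix a cylinder \<open>vX\<^sup>\<omega>\<close> below which no idempotent is annihilated by \<open>a\<close>, small enough that the terms
of \<open>a\<close> are pairwise separated on it. Then \<open>a vv\<^sup>*\<close> is a nonzero combination of partial maps with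
pairwise distinct values at each point where they are defined. Compressing by small
neighbourhoods of a point \<open>\<xi>\<close> and of its image \<open>\<eta>\<close> under one of these maps kills all others and
leaves a nonzero multiple of an element of \<open>S\<close>, from which \<open>1\<close> is obtained by multiplication.
\<close>

lemma nonsingular_generates_one:
  fixes a :: "('x, 'g) iselem \<Rightarrow>\<^sub>0 'k::field"
  assumes "a \<in> carrier (K0S G \<phi>)" "a \<notin> singular_ideal IS Zero"
  obtains x y where "x \<in> carrier (K0S G \<phi>)" "y \<in> carrier (K0S G \<phi>)" "IS.cm (IS.cm x a) y = \<one>\<^bsub>K0S G \<phi>\<^esub>"
proof -
  let ?A = "Poly_Mapping.keys a" and ?act = "partial_act G \<phi>"
  have a: "?A \<subseteq> carrier IS - {Zero}" using assms(1) by (simp add: mem_K0S)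
  obtain v0 where v0: "\<And>w. IS.cm a (csingle Zero (cyl (v0 @ w)) 1) \<noteq> 0"
    using assms by (auto simp: singular_ideal_iff)
  obtain w where "\<forall>(s, t)\<in>?A \<times> ?A. separated (v0 @ w) s t"
    using all_separated_extension[of "?A \<times> ?A" v0] a by auto
  moreover define v where "v = v0 @ w"
  ultimately have sep: "separated v s t" if "s \<in> ?A" "t \<in> ?A" for s t using that by auto
  define b where "b = IS.cm a (csingle Zero (cyl v) 1)"
  have "b \<noteq> 0" using v0 by (simp add: b_def v_def)
  then obtain r where r: "Poly_Mapping.lookup b r \<noteq> 0" by (metis poly_mapping_eqI lookup_zero)
  have "Poly_Mapping.keys b \<subseteq> carrier IS - {Zero}"
    unfolding b_def by (rule IS.cm_closed[OF a IS.csingle_in[OF cyl_closed]])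
  then have rZ: "r \<noteq> Zero" using r by (auto simp: in_keys_iff)
  have d: "Poly_Mapping.lookup b r = (\<Sum>s\<in>{s \<in> ?A. s \<otimes>\<^bsub>IS\<^esub> cyl v = r}. Poly_Mapping.lookup a s)"
    unfolding b_def by (rule IS.lookup_cm_csingle_right[OF a cyl_closed rZ])
  have "{s \<in> ?A. s \<otimes>\<^bsub>IS\<^esub> cyl v = r} \<noteq> {}" using r d by force
  then obtain s0 where s0: "s0 \<in> ?A" "s0 \<otimes>\<^bsub>IS\<^esub> cyl v = r" by blast
  have carr: "s \<in> carrier IS" if "s \<in> ?A" for s using a that by auto
  have rc: "r \<in> carrier IS" using s0 carr cyl_closed by auto
  have act_v: "?act (s \<otimes>\<^bsub>IS\<^esub> cyl v) \<xi> = (if stake (length v) \<xi> = v then ?act s \<xi> else None)" if "s \<in> ?A" for s \<xi>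
    using carr[OF that] cyl_closed by (simp add: partial_act_times partial_act_cyl del: partial_act.simps)
  obtain \<xi> where \<xi>: "?act r \<xi> \<noteq> None"
    using rZ rc by (cases r) (metis partial_act_shift option.distinct(1))+
  then have \<xi>v: "stake (length v) \<xi> = v" using act_v[OF s0(1), of \<xi>] s0(2) by (auto split: if_splits)
  obtain \<eta> where \<eta>: "?act r \<xi> = Some \<eta>" using \<xi> by blast
  \<comment> \<open>By separation, the value at the one point \<open>\<xi>\<close> determines the restriction of a term to the cylinder.\<close>
  have mem_iff: "s \<otimes>\<^bsub>IS\<^esub> cyl v = r \<longleftrightarrow> ?act s \<xi> = Some \<eta>" if s: "s \<in> ?A" for s
  proof
    assume "s \<otimes>\<^bsub>IS\<^esub> cyl v = r"
    then show "?act s \<xi> = Some \<eta>" using act_v[OF s, of \<xi>] \<eta> \<xi>v by simp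
  next
    assume "?act s \<xi> = Some \<eta>"
    then have "?act s \<xi> = ?act s0 \<xi>" using act_v[OF s0(1), of \<xi>] \<eta> \<xi>v s0(2) by simp
    moreover obtain \<xi>' where "\<xi> = v @- \<xi>'" using \<xi>v shift_eq by blast
    ultimately have same: "?act s (v @- \<zeta>) = ?act s0 (v @- \<zeta>)" for \<zeta>
      using sep[OF s s0(1)] unfolding separated_def by blast
    have "?act (s \<otimes>\<^bsub>IS\<^esub> cyl v) \<zeta> = ?act (s0 \<otimes>\<^bsub>IS\<^esub> cyl v) \<zeta>" for \<zeta>
      unfolding act_v[OF s] act_v[OF s0(1)] using same shift_eq[of v \<zeta>] by auto
    then show "s \<otimes>\<^bsub>IS\<^esub> cyl v = r"
      unfolding s0(2)[symmetric] using carr s s0(1) cyl_closed by (intro partial_act_inj) auto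
  qed
  have A: "?A \<subseteq> carrier IS" using a by auto
  obtain m n where n: "length v \<le> n" and iso: "\<And>s \<xi>'. s \<in> ?A \<Longrightarrow> stake n \<xi>' = stake n \<xi> \<Longrightarrow>
      map_option (stake m) (?act s \<xi>') = Some (stake m \<eta>) \<longleftrightarrow> ?act s \<xi> = Some \<eta>"
    by (rule values_isolated[OF finite_keys A, where k = "length v" and \<xi> = \<xi> and \<eta> = \<eta>], rule that, assumption)
  let ?p = "cyl (stake m \<eta>)" and ?q = "cyl (stake n \<xi>)"
  define r' where "r' = r \<otimes>\<^bsub>IS\<^esub> ?q"
  have r'c: "r' \<in> carrier IS" unfolding r'_def using rc cyl_closed by simp
  have act_q: "?act (s \<otimes>\<^bsub>IS\<^esub> ?q) \<xi>' = (if stake n \<xi>' = stake n \<xi> then ?act s \<xi>' else None)"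
    if "s \<in> carrier IS" for s \<xi>'
    using that cyl_closed by (simp add: partial_act_times partial_act_cyl del: partial_act.simps)
  have "?act r' \<xi> = Some \<eta>" using act_q[OF rc, of \<xi>] \<eta> by (simp add: r'_def)
  then have r'Z: "r' \<noteq> Zero" by auto
  \<comment> \<open>The compression keeps the terms that restrict to \<open>r\<close> and kills the rest.\<close>
  have corner: "?p \<otimes>\<^bsub>IS\<^esub> s \<otimes>\<^bsub>IS\<^esub> ?q = (if s \<otimes>\<^bsub>IS\<^esub> cyl v = r then r' else Zero)" if s: "s \<in> ?A" for s
  proof (rule partial_act_inj)
    fix \<xi>'
    have L: "?act (?p \<otimes>\<^bsub>IS\<^esub> s \<otimes>\<^bsub>IS\<^esub> ?q) \<xi>' =
        (if stake n \<xi>' = stake n \<xi> \<and> map_option (stake m) (?act s \<xi>') = Some (stake m \<eta>) then ?act s \<xi>' else None)"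
      using carr[OF s] cyl_closed
      by (cases "?act s \<xi>'") (auto simp: act_q partial_act_times partial_act_cyl simp del: partial_act.simps)
    have R: "?act r' \<xi>' = (if stake n \<xi>' = stake n \<xi> then ?act s \<xi>' else None)" if "s \<otimes>\<^bsub>IS\<^esub> cyl v = r"
    proof -
      have "stake (length v) \<xi>' = v" if "stake n \<xi>' = stake n \<xi>"
        using stake_eq_mono[OF that n] \<xi>v by simp
      then show ?thesis
        using act_q[OF rc, of \<xi>'] act_v[OF s, of \<xi>'] that by (auto simp: r'_def)
    qed
    show "?act (?p \<otimes>\<^bsub>IS\<^esub> s \<otimes>\<^bsub>IS\<^esub> ?q) \<xi>' = ?act (if s \<otimes>\<^bsub>IS\<^esub> cyl v = r then r' else Zero) \<xi>'"
      using L R iso[OF s, of \<xi>'] mem_iff[OF s] by (auto simp del: partial_act.simps(2))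
  qed (use carr[OF s] cyl_closed r'c in auto)
  \<comment> \<open>All surviving terms have become the same element \<open>r'\<close>, and their coefficients add up to that of \<open>r\<close> in \<open>b\<close>.\<close>
  define c where "c = Poly_Mapping.lookup b r"
  have c0: "c \<noteq> 0" using r by (simp add: c_def)
  have "IS.cm (IS.cm (csingle Zero ?p 1) a) (csingle Zero ?q 1) =
      (\<Sum>s\<in>?A. csingle Zero (if s \<otimes>\<^bsub>IS\<^esub> cyl v = r then r' else Zero) (Poly_Mapping.lookup a s))"
    unfolding IS.cm_sandwich[OF a cyl_closed cyl_closed] by (intro sum.cong refl arg_cong2[where f = "csingle Zero"] corner)
  also have "\<dots> = (\<Sum>s\<in>{s \<in> ?A. s \<otimes>\<^bsub>IS\<^esub> cyl v = r}. csingle Zero r' (Poly_Mapping.lookup a s))"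
    by (subst sum.inter_filter) (auto intro!: sum.cong)
  also have "\<dots> = csingle Zero r' c"
    unfolding c_def d by (rule csingle_sum[symmetric])
  finally have cut: "IS.cm (IS.cm (csingle Zero ?p 1) a) (csingle Zero ?q 1) = csingle Zero r' c" .
  obtain p' q' where pq: "p' \<in> carrier IS" "q' \<in> carrier IS" "p' \<otimes>\<^bsub>IS\<^esub> r' \<otimes>\<^bsub>IS\<^esub> q' = cyl []"
    using unit_sandwich[OF r'c r'Z] .
  define x y where "x = IS.cm (csingle Zero p' (1 / c)) (csingle Zero ?p 1)"
    and "y = IS.cm (csingle Zero ?q 1) (csingle Zero q' (1::'k))"
  interpret R: ring "K0S G \<phi> :: (('x, 'g) iselem \<Rightarrow>\<^sub>0 'k) ring" by (rule IS.ring_contracted_algebra)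
  note [simp] = IS.mult_contracted_algebra
  have mem: "csingle Zero p' (1 / c) \<in> carrier (K0S G \<phi>)" "csingle Zero ?p (1::'k) \<in> carrier (K0S G \<phi>)"
    "csingle Zero ?q (1::'k) \<in> carrier (K0S G \<phi>)" "csingle Zero q' (1::'k) \<in> carrier (K0S G \<phi>)"
    using pq cyl_closed by (simp_all add: csingle_mem)
  have "IS.cm (IS.cm x a) y = IS.cm (IS.cm (csingle Zero p' (1 / c)) (IS.cm (IS.cm (csingle Zero ?p 1) a) (csingle Zero ?q 1))) (csingle Zero q' 1)"
    using mem assms(1) R.m_assoc R.m_closed by (simp add: x_def y_def)
  also have "\<dots> = \<one>\<^bsub>K0S G \<phi>\<^esub>"
    unfolding cut using pq r'c c0 by (simp add: IS.cm_csingle one_K0S)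
  finally show ?thesis
    using that[of x y] mem R.m_closed by (simp add: x_def y_def)
qed

lemma ring_End_ring: "ring (End_ring :: (('b \<Rightarrow>\<^sub>0 'k) \<Rightarrow> ('b \<Rightarrow>\<^sub>0 'k::field)) ring)"
proof -
  let ?E = "End_ring :: (('b \<Rightarrow>\<^sub>0 'k) \<Rightarrow> ('b \<Rightarrow>\<^sub>0 'k)) ring"
  interpret V: vector_space "vscale :: 'k \<Rightarrow> ('b \<Rightarrow>\<^sub>0 'k) \<Rightarrow> ('b \<Rightarrow>\<^sub>0 'k)"
    by (rule vector_space_vscale)
  have carr: "T \<in> carrier ?E \<longleftrightarrow> (\<forall>u v. T (u + v) = T u + T v) \<and> (\<forall>c v. T (vscale c v) = vscale c (T v))" for T
    by (simp add: End_ring_def Vector_Spaces.linear_iff V.vector_space_axioms)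
  have ops: "add ?E = (\<lambda>T U v. T v + U v)" "zero ?E = (\<lambda>_. 0)" "mult ?E = (\<circ>)" "one ?E = id"
    by (simp_all add: End_ring_def)
  show ?thesis
  proof (rule ringI)
    show "abelian_group ?E"
    proof (rule abelian_groupI)
      fix T assume "T \<in> carrier ?E"
      then show "\<exists>U\<in>carrier ?E. U \<oplus>\<^bsub>?E\<^esub> T = \<zero>\<^bsub>?E\<^esub>"
        by (intro bexI[of _ "\<lambda>v. - T v"]) (auto simp: carr ops V.scale_minus_right)
    qed (auto simp: carr ops add.assoc add.commute add.left_commute V.scale_right_distrib)
    show "Group.monoid ?E"
      by (rule monoidI) (auto simp: carr ops)
  qed (auto simp: carr ops)
qed

lemma K0S_ring_hom_ring:
  "ring_hom_ring (K0S G \<phi> :: (('x, 'g) iselem \<Rightarrow>\<^sub>0 'k::field) ring) End_ring (stream_rep G \<phi>)"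
  by (intro ring_hom_ringI2 IS.ring_contracted_algebra ring_End_ring rep_ring_hom)

text \<open>
This makes the singular ideal the largest proper ideal, once it is known to be an ideal.
\<close>

lemma ideal_not_singular_eq_carrier:
  fixes J :: "(('x, 'g) iselem \<Rightarrow>\<^sub>0 'k::field) set"
  assumes J: "ideal J (K0S G \<phi>)" and "\<not> J \<subseteq> singular_ideal IS Zero"
  shows "J = carrier (K0S G \<phi>)"
proof -
  interpret J: ideal J "K0S G \<phi>" by (rule J)
  obtain a where a: "a \<in> J" "a \<notin> singular_ideal IS Zero" using assms(2) by blast
  obtain x y where xy: "x \<in> carrier (K0S G \<phi>)" "y \<in> carrier (K0S G \<phi>)" "IS.cm (IS.cm x a) y = \<one>\<^bsub>K0S G \<phi>\<^esub>"
    using nonsingular_generates_one[OF J.Icarr[OF a(1)] a(2)] .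
  then have "\<one>\<^bsub>K0S G \<phi>\<^esub> \<in> J"
    using J.I_r_closed[OF J.I_l_closed[OF a(1) xy(1)] xy(2)] by (simp add: IS.mult_contracted_algebra)
  then show ?thesis by (rule J.one_imp_carrier)
qed

lemma kernel_iff:
  "a \<in> a_kernel (K0S G \<phi>) End_ring (stream_rep G \<phi>) \<longleftrightarrow> a \<in> carrier (K0S G \<phi>) \<and> stream_rep G \<phi> a = (\<lambda>_. 0)"
  by (simp add: a_kernel_def' End_ring_def)

lemma rep_one_nonzero: "stream_rep G \<phi> \<one>\<^bsub>K0S G \<phi>\<^esub> \<noteq> (\<lambda>_. 0 :: _ \<Rightarrow>\<^sub>0 'k::field)"
proof
  assume "stream_rep G \<phi> \<one>\<^bsub>K0S G \<phi>\<^esub> = (\<lambda>_. 0 :: _ \<Rightarrow>\<^sub>0 'k)"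
  then have "Poly_Mapping.single undefined (1::'k) = (0 :: 'x stream \<Rightarrow>\<^sub>0 'k)"
    using rep_one[of "Poly_Mapping.single undefined (1::'k)"] by (simp add: one_K0S)
  then show False by (metis lookup_single_eq lookup_zero zero_neq_one)
qed

text \<open>
The inclusion of the kernel in the singular ideal is formal: the kernel is a proper ideal, and
every ideal not contained in the singular ideal contains \<open>1\<close>.
\<close>

lemma kernel_eq_singular:
  "a_kernel (K0S G \<phi> :: (('x, 'g) iselem \<Rightarrow>\<^sub>0 'k::field) ring) End_ring (stream_rep G \<phi>) = singular_ideal IS Zero"
    (is "?ker = ?I")
proof
  interpret h: ring_hom_ring "K0S G \<phi> :: (('x, 'g) iselem \<Rightarrow>\<^sub>0 'k) ring" End_ring "stream_rep G \<phi>"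
    by (rule K0S_ring_hom_ring)
  have "\<one>\<^bsub>K0S G \<phi>\<^esub> \<notin> ?ker"
    using rep_one_nonzero by (simp only: kernel_iff) blast
  then have "?ker \<noteq> carrier (K0S G \<phi>)" using h.R.one_closed by blast
  then show "?ker \<subseteq> ?I" using ideal_not_singular_eq_carrier[OF h.kernel_is_ideal] by blast
  show "?I \<subseteq> ?ker"
  proof
    fix a :: "('x, 'g) iselem \<Rightarrow>\<^sub>0 'k" assume "a \<in> ?I"
    then show "a \<in> ?ker"
      using singular_acts_trivially[of a] unfolding kernel_iff singular_ideal_iff by blast
  qed
qed

end

section \<open>The tight ideal is the Cuntz--Krieger ideal\<close>

context monoid_with_zero
begin

lemma cm_diff_left: "cm (a - b) c = cm a c - cm b c"
  using cm_add_left[of "a - b" b c] by (simp add: algebra_simps)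

lemma cm_diff_right: "cm c (a - b) = cm c a - cm c b"
  using cm_add_right[of c "a - b" b] by (simp add: algebra_simps)

lemma add_contracted_algebra: "add (contracted_algebra S z) a b = a + b"
  by (simp add: contracted_algebra_def)

lemma zero_contracted_algebra: "zero (contracted_algebra S z) = 0"
  by (simp add: contracted_algebra_def)

lemma minus_contracted_algebra:
  fixes a b :: "'s \<Rightarrow>\<^sub>0 'k::field"
  assumes "a \<in> carrier (contracted_algebra S z)" "b \<in> carrier (contracted_algebra S z)"
  shows "a \<ominus>\<^bsub>contracted_algebra S z\<^esub> b = a - b"
proof -
  interpret R: ring "contracted_algebra S z :: ('s \<Rightarrow>\<^sub>0 'k) ring" by (rule ring_contracted_algebra)
  have "- b \<in> carrier (contracted_algebra S z)" using assms(2) by (simp add: contracted_algebra_def)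
  then have "\<ominus>\<^bsub>contracted_algebra S z\<^esub> b = - b"
    using assms(2) by (intro R.minus_equality) (simp_all add: contracted_algebra_def)
  then show ?thesis by (simp add: a_minus_def add_contracted_algebra)
qed

lemma ideal_sum_closed:
  assumes "ideal J (contracted_algebra S z)" "\<And>i. i \<in> I \<Longrightarrow> f i \<in> J"
  shows "(\<Sum>i\<in>I. f i) \<in> J"
proof -
  interpret J: ideal J "contracted_algebra S z" by fact
  show ?thesis
    using assms(2) additive_subgroup.zero_closed[OF ideal.axioms(1)[OF assms(1)]]
      additive_subgroup.a_closed[OF ideal.axioms(1)[OF assms(1)]]
    by (induction I rule: infinite_finite_induct) (auto simp: add_contracted_algebra zero_contracted_algebra)
qed

lemma cover_product_simps:
  "cover_product S z e [] = csingle z e 1"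
  "cover_product S z e (f # fs) = cm (csingle z e 1 - csingle z f 1) (cover_product S z e fs)"
  by (simp_all add: cover_product_def cm_def)

lemma cover_product_closed:
  assumes "e \<in> carrier S" "set fs \<subseteq> carrier S"
  shows "Poly_Mapping.keys (cover_product S z e fs) \<subseteq> carrier S - {z}"
  using assms(2)
proof (induction fs)
  case (Cons f fs)
  then have "Poly_Mapping.keys (csingle z e 1 - csingle z f 1) \<subseteq> carrier S - {z}"
    using Poly_Mapping.keys_diff[of "csingle z e 1" "csingle z f 1"] csingle_in[of e 1] csingle_in[of f 1] assms(1) by auto
  then show ?case using Cons cm_closed by (simp add: cover_product_simps)
qed (use assms(1) csingle_in in \<open>simp add: cover_product_simps\<close>)

lemma cover_product_Cons_times:
  assumes "e \<in> carrier S" "set (f # fs) \<subseteq> carrier S" "q \<in> carrier S"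
  shows "cm (cover_product S z e (f # fs)) (csingle z q 1) =
    cm (csingle z e 1 - csingle z f 1) (cm (cover_product S z e fs) (csingle z q 1))"
proof -
  have "Poly_Mapping.keys (csingle z e 1 - csingle z f 1) \<subseteq> carrier S - {z}"
    using Poly_Mapping.keys_diff[of "csingle z e 1" "csingle z f 1"] csingle_in[of e 1] csingle_in[of f 1] assms by auto
  then show ?thesis
    unfolding cover_product_simps using assms by (intro cm_assoc cover_product_closed csingle_in) auto
qed

text \<open>
The fold that defines a cover product starts from \<open>e\<close>, and \<open>e\<close> is idempotent.
\<close>

lemma cover_product_times_top:
  assumes "e \<in> idempotents S" "set fs \<subseteq> carrier S"
  shows "cm (cover_product S z e fs) (csingle z e 1) = (cover_product S z e fs :: 's \<Rightarrow>\<^sub>0 'k::field)"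
  using assms(2)
proof (induction fs)
  case Nil
  then show ?case using assms(1) by (simp add: cover_product_simps cm_csingle idempotents_def)
next
  case (Cons f fs)
  then have "cm (cover_product S z e (f # fs)) (csingle z e (1::'k)) =
      cm (csingle z e 1 - csingle z f 1) (cm (cover_product S z e fs) (csingle z e 1))"
    using assms(1) by (intro cover_product_Cons_times) (auto simp: idempotents_def)
  then show ?case using Cons by (simp add: cover_product_simps(2))
qed

text \<open>
For \<open>e = 0\<close> the fold starts from \<open>0\<close>, so even the empty cover of \<open>0\<close> contributes only \<open>0\<close>.
\<close>

lemma cover_product_zero: "cover_product S z z fs = 0"
  by (induction fs) (simp_all add: cover_product_simps)

end

context self_similar_group
begin

lemma cyl_times:
  "cyl u \<otimes>\<^bsub>IS\<^esub> cyl w = (if prefix u w then cyl w else if prefix w u then cyl u else Zero)"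
  by (auto simp: mult_IS prefix_def)

text \<open>
On a cylinder \<open>wX\<^sup>\<omega>\<close> that is no larger than those of the cover, each factor \<open>e - f\<close> acts as \<open>0\<close> or
as the identity, according to whether \<open>f\<close> meets the cylinder.
\<close>

lemma cover_product_times_cyl:
  assumes "prefix v w" "set fs \<subseteq> idempotents IS" "\<And>u. cyl u \<in> set fs \<Longrightarrow> length u \<le> length w"
  shows "IS.cm (cover_product IS Zero (cyl v) fs) (csingle Zero (cyl w) 1) =
    (if \<exists>f\<in>set fs. cyl w \<otimes>\<^bsub>IS\<^esub> f \<noteq> Zero then 0 else csingle Zero (cyl w) (1::'k::field))"
  using assms(2,3)
proof (induction fs)
  case Nil
  then show ?case using assms(1) by (simp add: IS.cover_product_simps IS.cm_csingle cyl_closed cyl_times)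
next
  case (Cons f fs)
  have sub: "set (f # fs) \<subseteq> carrier IS" using Cons.prems by (auto simp: idempotents_def)
  consider "f = Zero" | u where "f = cyl u" "length u \<le> length w"
    using Cons.prems by (auto simp: idempotents_IS)
  then have f: "cyl w \<otimes>\<^bsub>IS\<^esub> f = f \<otimes>\<^bsub>IS\<^esub> cyl w \<and> f \<otimes>\<^bsub>IS\<^esub> cyl w \<in> {Zero, cyl w}"
    by cases (auto simp: cyl_times mult_IS[of Zero] mult_IS[of _ Zero] prefix_def)
  have "IS.cm (csingle Zero (cyl v) 1 - csingle Zero f 1) (csingle Zero (cyl w) (1::'k)) =
      csingle Zero (cyl w) 1 - csingle Zero (f \<otimes>\<^bsub>IS\<^esub> cyl w) 1"
    using assms(1) sub by (simp add: IS.cm_diff_left IS.cm_csingle cyl_closed cyl_times)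
  moreover have "IS.cm (cover_product IS Zero (cyl v) fs) (csingle Zero (cyl w) 1) =
    (if \<exists>f\<in>set fs. cyl w \<otimes>\<^bsub>IS\<^esub> f \<noteq> Zero then 0 else csingle Zero (cyl w) (1::'k))"
    using Cons.prems by (intro Cons.IH) auto
  ultimately show ?case
    using f unfolding IS.cover_product_Cons_times[OF cyl_closed sub cyl_closed] by auto
qed

text \<open>
The generator of the Cuntz--Krieger ideal, with every term given by \<open>csingle\<close>: products of such
terms are computed in \<open>S\<close>.
\<close>

definition ck_gen :: "('x, 'g) iselem \<Rightarrow>\<^sub>0 'k::field" where
  "ck_gen = csingle Zero (cyl []) 1 - (\<Sum>x\<in>UNIV. csingle Zero (cyl [x]) 1)"

lemma cuntz_krieger_ideal_eq: "cuntz_krieger_ideal G \<phi> = genideal (K0S G \<phi>) {ck_gen}"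
  by (simp add: cuntz_krieger_ideal_def ck_gen_def one_K0S csingle_def)

lemma K0S_diff: "a \<in> carrier (K0S G \<phi>) \<Longrightarrow> b \<in> carrier (K0S G \<phi>) \<Longrightarrow> a - b \<in> carrier (K0S G \<phi>)"
  using Poly_Mapping.keys_diff[of a b] by (auto simp: mem_K0S)

lemma K0S_sum: "(\<And>i. i \<in> I \<Longrightarrow> f i \<in> carrier (K0S G \<phi>)) \<Longrightarrow> (\<Sum>i\<in>I. f i) \<in> carrier (K0S G \<phi>)"
  using keys_sum_subset[of f I] by (fastforce simp: mem_K0S)

lemma ck_gen_mem: "ck_gen \<in> carrier (K0S G \<phi>)"
  unfolding ck_gen_def by (intro K0S_diff K0S_sum csingle_mem cyl_closed)

text \<open>
The projections \<open>xx\<^sup>*\<close> are orthogonal, so the mixed terms of \<open>\<Prod>(1 - xx\<^sup>*)\<close> vanish.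
\<close>

lemma ck_gen_eq_cover_product:
  assumes "distinct xs" "set xs = UNIV"
  shows "cover_product IS Zero (cyl []) (map (\<lambda>x. cyl [x]) xs) = (ck_gen :: ('x, 'g) iselem \<Rightarrow>\<^sub>0 'k::field)"
proof -
  have "cover_product IS Zero (cyl []) (map (\<lambda>x. cyl [x]) ys) =
      csingle Zero (cyl []) 1 - (\<Sum>x\<in>set ys. csingle Zero (cyl [x]) (1::'k))" if "distinct ys" for ys
    using that
  proof (induction ys)
    case Nil
    then show ?case by (simp add: IS.cover_product_simps)
  next
    case (Cons y ys)
    have "IS.cm (csingle Zero (cyl [y]) (1::'k)) (\<Sum>x\<in>set ys. csingle Zero (cyl [x]) 1) = 0"
      unfolding IS.cm_sum_right using Cons.prems
      by (intro sum.neutral ballI) (auto simp: IS.cm_csingle cyl_closed cyl_times)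
    moreover have "IS.cm (csingle Zero (cyl []) (1::'k)) (\<Sum>x\<in>set ys. csingle Zero (cyl [x]) 1) = (\<Sum>x\<in>set ys. csingle Zero (cyl [x]) 1)"
      unfolding IS.cm_sum_right by (intro sum.cong refl) (simp add: IS.cm_csingle cyl_closed cyl_times)
    ultimately show ?case
      using Cons by (simp add: IS.cover_product_simps IS.cm_diff_left IS.cm_diff_right IS.cm_csingle cyl_closed cyl_times)
  qed
  from this[OF assms(1)] show ?thesis by (simp add: ck_gen_def assms(2))
qed

lemma letters_cover: "covers IS Zero (range (\<lambda>x. cyl [x])) (cyl [])"
proof -
  have "\<exists>x. cyl w \<otimes>\<^bsub>IS\<^esub> cyl [x] \<noteq> Zero" for w
    by (cases w) (auto simp: cyl_times)
  then show ?thesis by (auto simp: covers_def idempotents_IS idem_le_IS)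
qed

text \<open>
Conjugating the generator by \<open>w\<close> gives \<open>ww\<^sup>* - \<Sum> wx(wx)\<^sup>*\<close>.
\<close>

lemma ck_refinement:
  assumes "ideal J (K0S G \<phi>)" "ck_gen \<in> J"
  shows "csingle Zero (cyl w) 1 - (\<Sum>x\<in>UNIV. csingle Zero (cyl (w @ [x])) 1) \<in> J"
proof -
  interpret J: ideal J "K0S G \<phi>" by fact
  let ?l = "Elem w \<one> []" and ?r = "Elem [] \<one> w"
  have c: "?l \<in> carrier IS" "?r \<in> carrier IS" by (simp_all add: inv_semigroup_def)
  have m: "?l \<otimes>\<^bsub>IS\<^esub> cyl p \<otimes>\<^bsub>IS\<^esub> ?r = cyl (w @ p)" for p
    by (cases p) (simp_all add: mult_IS)
  have e: "IS.cm (IS.cm (csingle Zero ?l 1) (csingle Zero (cyl p) 1)) (csingle Zero ?r 1) = csingle Zero (cyl (w @ p)) 1" for p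
    using c cyl_closed[of p] by (simp add: IS.cm_csingle m)
  have "IS.cm (IS.cm (csingle Zero ?l 1) ck_gen) (csingle Zero ?r 1) \<in> J"
    using J.I_r_closed[OF J.I_l_closed[OF assms(2) csingle_mem[OF c(1)]] csingle_mem[OF c(2)]]
    by (simp add: IS.mult_contracted_algebra)
  then show ?thesis
    by (simp add: ck_gen_def IS.cm_diff_left IS.cm_diff_right IS.cm_sum_left IS.cm_sum_right e)
qed

text \<open>
Let \<open>P\<close> be the cover product. If \<open>w\<close> is at least as long as all words of the cover, then some
member of the cover lies above \<open>ww\<^sup>*\<close> and \<open>P ww\<^sup>* = 0\<close>. Modulo the generator, \<open>ww\<^sup>*\<close> is the sum of the
\<open>wx(wx)\<^sup>*\<close>, so the property that \<open>P ww\<^sup>*\<close> lies in the ideal passes from the one-letter extensions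
of \<open>w\<close> to \<open>w\<close>. Descending in length reaches \<open>w = v\<close>, where \<open>P vv\<^sup>* = P\<close>.
\<close>

lemma cover_product_in_ck:
  fixes J :: "(('x, 'g) iselem \<Rightarrow>\<^sub>0 'k::field) set"
  assumes J: "ideal J (K0S G \<phi>)" and gen: "ck_gen \<in> J"
    and e: "e \<in> idempotents IS" and cov: "covers IS Zero (set fs) e"
  shows "cover_product IS Zero e fs \<in> J"
proof (cases "e = Zero")
  case True
  then show ?thesis
    using additive_subgroup.zero_closed[OF ideal.axioms(1)[OF J]]
    by (simp add: IS.cover_product_zero IS.zero_contracted_algebra)
next
  case False
  then obtain v where v: "e = cyl v" using e by (auto simp: idempotents_IS)
  interpret J: ideal J "K0S G \<phi>" by (rule J)
  let ?P = "cover_product IS Zero (cyl v) fs :: ('x, 'g) iselem \<Rightarrow>\<^sub>0 'k"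
  have idem: "set fs \<subseteq> idempotents IS" using cov by (simp add: covers_def)
  then have sub: "set fs \<subseteq> carrier IS" by (auto simp: idempotents_def)
  have P: "?P \<in> carrier (K0S G \<phi>)"
    using IS.cover_product_closed[OF cyl_closed sub] by (simp add: mem_K0S)
  define len :: "('x, 'g) iselem \<Rightarrow> nat" where "len = case_iselem 0 (\<lambda>u g v. length u)"
  obtain N where "\<forall>n\<in>len ` set fs. n \<le> N" using finite_nat_set_iff_bounded_le by (metis finite_imageI finite_set)
  then have N: "length u \<le> N" if "cyl u \<in> set fs" for u using that by (force simp: len_def)
  have "IS.cm ?P (csingle Zero (cyl w) 1) \<in> J" if "prefix v w" for w
    using that
  proof (induction "N - length w" arbitrary: w rule: less_induct)
    case less
    show ?case
    proof (cases "N \<le> length w")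
      case True
      have "cyl w \<in> idempotents IS" "cyl w \<noteq> Zero \<and> idem_le IS (cyl w) (cyl v)"
        using less.prems by (simp_all add: idempotents_IS idem_le_IS)
      then have "\<exists>f\<in>set fs. cyl w \<otimes>\<^bsub>IS\<^esub> f \<noteq> Zero"
        using cov unfolding covers_def v by metis
      then have "IS.cm ?P (csingle Zero (cyl w) 1) = 0"
        by (subst cover_product_times_cyl[OF less.prems idem order_trans[OF N True]]) simp_all
      then show ?thesis
        using additive_subgroup.zero_closed[OF ideal.axioms(1)[OF J]] by (simp add: IS.zero_contracted_algebra)
    next
      case False
      have "IS.cm ?P (csingle Zero (cyl (w @ [x])) 1) \<in> J" for x
        using False less.prems by (intro less.hyps) (auto simp: prefix_def)
      then have "(\<Sum>x\<in>UNIV. IS.cm ?P (csingle Zero (cyl (w @ [x])) 1)) \<in> J"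
        by (intro IS.ideal_sum_closed[OF J]) simp
      moreover have "IS.cm ?P (csingle Zero (cyl w) 1 - (\<Sum>x\<in>UNIV. csingle Zero (cyl (w @ [x])) 1)) \<in> J"
        using J.I_l_closed[OF ck_refinement[OF J gen] P] by (simp add: IS.mult_contracted_algebra)
      ultimately show ?thesis
        using additive_subgroup.a_closed[OF ideal.axioms(1)[OF J]] by (fastforce simp: IS.cm_diff_right IS.cm_sum_right IS.add_contracted_algebra)
    qed
  qed
  from this[of v] have "IS.cm ?P (csingle Zero e 1) \<in> J" by (simp add: v)
  then show ?thesis unfolding v[symmetric] IS.cover_product_times_top[OF e sub] .
qed

lemma tight_eq_cuntz_krieger:
  "tight_ideal IS Zero = (cuntz_krieger_ideal G \<phi> :: (('x, 'g) iselem \<Rightarrow>\<^sub>0 'k::field) set)"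
proof -
  interpret R: ring "K0S G \<phi> :: (('x, 'g) iselem \<Rightarrow>\<^sub>0 'k) ring" by (rule IS.ring_contracted_algebra)
  let ?gens = "{cover_product IS Zero e fs | e fs. e \<in> idempotents IS \<and> distinct fs \<and> covers IS Zero (set fs) e}
     :: (('x, 'g) iselem \<Rightarrow>\<^sub>0 'k) set"
  have gens: "?gens \<subseteq> carrier (K0S G \<phi>)"
  proof -
    have "cover_product IS Zero e fs \<in> carrier (K0S G \<phi>)"
      if "e \<in> idempotents IS" "covers IS Zero (set fs) e" for e fs
      unfolding mem_K0S using that by (intro IS.cover_product_closed) (auto simp: idempotents_def covers_def)
    then show ?thesis by blast
  qed
  have ck: "{ck_gen} \<subseteq> carrier (K0S G \<phi>)" using ck_gen_mem by blast
  obtain xs :: "'x list" where xs: "distinct xs" "set xs = UNIV" using finite_distinct_list by (metis finite)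
  have "ck_gen \<in> ?gens"
  proof -
    have "distinct (map (\<lambda>x. cyl [x]) xs)" using xs by (auto simp: distinct_map inj_on_def)
    moreover have "covers IS Zero (set (map (\<lambda>x. cyl [x]) xs)) (cyl [])" using letters_cover by (simp add: xs)
    moreover have "cyl [] \<in> idempotents IS" by (simp add: idempotents_IS)
    ultimately show ?thesis using ck_gen_eq_cover_product[OF xs, symmetric] by blast
  qed
  then have "Idl\<^bsub>K0S G \<phi>\<^esub> {ck_gen} \<subseteq> Idl\<^bsub>K0S G \<phi>\<^esub> ?gens"
    using gens by (intro R.subset_Idl_subset) auto
  moreover have "Idl\<^bsub>K0S G \<phi>\<^esub> ?gens \<subseteq> Idl\<^bsub>K0S G \<phi>\<^esub> {ck_gen}"
    using cover_product_in_ck[OF R.genideal_ideal[OF ck]] R.genideal_self[OF ck]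
    by (intro R.genideal_minimal[OF R.genideal_ideal[OF ck]]) blast
  ultimately show ?thesis
    unfolding tight_ideal_def cuntz_krieger_ideal_eq by blast
qed

end

section \<open>The Nekrashevych algebra\<close>

text \<open>
The hypotheses on \<open>M\<close> say that it is the largest proper ideal. Under the correspondence between
ideals of the quotient and ideals above \<open>C\<close>, the quotient then has \<open>M / C\<close> as its largest proper
ideal, and so it is simple exactly when \<open>M / C\<close> vanishes.
\<close>

lemma (in ring) simple_quotient_iff:
  assumes C: "ideal C R" and M: "ideal M R" and CM: "C \<subseteq> M" and proper: "\<one> \<notin> M"
    and max: "\<And>J. ideal J R \<Longrightarrow> \<not> J \<subseteq> M \<Longrightarrow> J = carrier R"
  shows "simple_algebra (R Quot C) \<longleftrightarrow> M \<subseteq> C"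
proof -
  interpret C: ideal C R by (rule C)
  interpret M: ideal M R by (rule M)
  have carr: "carrier (R Quot C) = (+>) C ` carrier R"
    by (auto simp: FactRing_def A_RCOSETS_def')
  have zero: "\<zero>\<^bsub>R Quot C\<^esub> = C" by (simp add: FactRing_def)
  show ?thesis
  proof
    assume "simple_algebra (R Quot C)"
    then consider "(+>) C ` M = {C}" | "(+>) C ` M = carrier (R Quot C)"
      using ring_ideal_imp_quot_ideal[OF C M] zero by (auto simp: simple_algebra_def)
    then show "M \<subseteq> C"
    proof cases
      case 1
      show ?thesis
      proof
        fix m assume "m \<in> M"
        then have "C +> m = C" using 1 by blast
        then show "m \<in> C" by (rule C.rcos_const_imp_mem[OF M.Icarr[OF \<open>m \<in> M\<close>]])
      qed
    next
      case 2
      then obtain m where m: "m \<in> M" "C +> \<one> = C +> m" using carr one_closed by (metis imageE imageI)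
      then have "\<one> \<ominus> m \<in> M"
        using quotient_eq_iff_same_a_r_cos[OF C one_closed M.Icarr[OF m(1)]] CM by blast
      then have "(\<one> \<ominus> m) \<oplus> m \<in> M" using m(1) additive_subgroup.a_closed[OF ideal.axioms(1)[OF M]] by blast
      moreover have "(\<one> \<ominus> m) \<oplus> m = \<one>" using M.Icarr[OF m(1)] by (simp add: a_minus_def a_assoc l_neg)
      ultimately show ?thesis using proper by simp
    qed
  next
    assume MC: "M \<subseteq> C"
    have "C +> \<one> \<noteq> C" using C.rcos_const_imp_mem[OF one_closed] proper CM by blast
    moreover have "C +> \<one> \<in> carrier (R Quot C)" using carr by blast
    ultimately have "carrier (R Quot C) \<noteq> {C}" by blast
    moreover have "J = {C} \<or> J = carrier (R Quot C)"
      if J: "ideal J (R Quot C)" and JC: "J \<subseteq> carrier (R Quot C)" for J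
    proof (cases "\<Union>J \<subseteq> C")
      case True
      have "K = C" if K: "K \<in> J" for K
      proof -
        obtain a where a: "a \<in> carrier R" "K = C +> a" using K JC carr by blast
        have "a \<in> C" using canonical_proj_vimage_mem_iff[OF C JC a(1)] K a(2) True by blast
        then show ?thesis unfolding a(2) by (rule a_rcos_zero[OF C])
      qed
      moreover have "C \<in> J" using additive_subgroup.zero_closed[OF ideal.axioms(1)[OF J]] zero by simp
      ultimately show ?thesis by blast
    next
      case False
      then have "\<Union>J = carrier R"
        using max[OF quot_ideal_imp_ring_ideal[OF C J]] MC CM by blast
      then have "C +> a \<in> J" if "a \<in> carrier R" for a
        using canonical_proj_vimage_mem_iff[OF C JC that] that by simp
      then have "carrier (R Quot C) \<subseteq> J" unfolding carr by (rule image_subsetI)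
      then show ?thesis using JC by (simp add: subset_antisym)
    qed
    ultimately show "simple_algebra (R Quot C)"
      unfolding simple_algebra_def zero
      using C.quotient_is_ring additive_subgroup.a_subset[OF ideal.axioms(1)] by metis
  qed
qed

context self_similar_group
begin

lemma singular_ideal_ideal: "ideal (singular_ideal IS Zero) (K0S G \<phi> :: (('x, 'g) iselem \<Rightarrow>\<^sub>0 'k::field) ring)"
  using ring_hom_ring.kernel_is_ideal[OF K0S_ring_hom_ring] unfolding kernel_eq_singular .

lemma singular_iff_acts_trivially:
  "a \<in> singular_ideal IS Zero \<longleftrightarrow> a \<in> carrier (K0S G \<phi>) \<and> stream_rep G \<phi> a = (\<lambda>_. 0)"
  unfolding kernel_eq_singular[symmetric] by (rule kernel_iff)

lemma cuntz_krieger_ideal_ideal: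
  "ideal (cuntz_krieger_ideal G \<phi>) (K0S G \<phi> :: (('x, 'g) iselem \<Rightarrow>\<^sub>0 'k::field) ring)"
proof -
  interpret R: ring "K0S G \<phi> :: (('x, 'g) iselem \<Rightarrow>\<^sub>0 'k) ring" by (rule IS.ring_contracted_algebra)
  show ?thesis
    unfolding cuntz_krieger_ideal_eq using ck_gen_mem by (intro R.genideal_ideal) simp
qed

lemma cuntz_krieger_subset_singular:
  "cuntz_krieger_ideal G \<phi> \<subseteq> (singular_ideal IS Zero :: (('x, 'g) iselem \<Rightarrow>\<^sub>0 'k::field) set)"
proof -
  interpret R: ring "K0S G \<phi> :: (('x, 'g) iselem \<Rightarrow>\<^sub>0 'k) ring" by (rule IS.ring_contracted_algebra)
  have "(ck_gen :: ('x, 'g) iselem \<Rightarrow>\<^sub>0 'k) \<in> singular_ideal IS Zero"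
    unfolding singular_iff_acts_trivially
    using ck_gen_mem ck_generator by (auto simp: ck_gen_def one_K0S csingle_def)
  then show ?thesis
    unfolding cuntz_krieger_ideal_eq by (intro R.genideal_minimal[OF singular_ideal_ideal]) simp
qed

lemma carrier_nekrashevych:
  "carrier (nekrashevych_algebra G \<phi>) = (+>\<^bsub>K0S G \<phi>\<^esub>) (cuntz_krieger_ideal G \<phi>) ` carrier (K0S G \<phi>)"
  by (auto simp: nekrashevych_algebra_def FactRing_def A_RCOSETS_def')

text \<open>
The Cuntz--Krieger ideal acts as zero, so the image of a coset under the representation is a
singleton.
\<close>

lemma nekrashevych_rep_coset:
  fixes a :: "('x, 'g) iselem \<Rightarrow>\<^sub>0 'k::field"
  assumes a: "a \<in> carrier (K0S G \<phi>)"
  shows "nekrashevych_rep G \<phi> (cuntz_krieger_ideal G \<phi> +>\<^bsub>K0S G \<phi>\<^esub> a) = stream_rep G \<phi> a"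
proof -
  let ?K = "cuntz_krieger_ideal G \<phi> +>\<^bsub>K0S G \<phi>\<^esub> a"
  interpret C: ideal "cuntz_krieger_ideal G \<phi>" "K0S G \<phi> :: (('x, 'g) iselem \<Rightarrow>\<^sub>0 'k) ring"
    by (rule cuntz_krieger_ideal_ideal)
  have "stream_rep G \<phi> b = stream_rep G \<phi> a" if b: "b \<in> ?K" for b
  proof -
    obtain c where c: "c \<in> cuntz_krieger_ideal G \<phi>" "b = c + a"
      using b by (auto simp: a_r_coset_def' IS.add_contracted_algebra)
    then have "stream_rep G \<phi> c = (\<lambda>_. 0)"
      using cuntz_krieger_subset_singular singular_acts_trivially by blast
    then show ?thesis using c rep_add_left[of c a] by (simp add: fun_eq_iff)
  qed
  moreover have "a \<in> ?K" using a by (rule C.a_rcos_self)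
  ultimately have "stream_rep G \<phi> ` ?K = {stream_rep G \<phi> a}" by blast
  then show ?thesis by (simp add: nekrashevych_rep_def)
qed

lemma nekrashevych_kernel:
  "a_kernel (nekrashevych_algebra G \<phi> :: (('x, 'g) iselem \<Rightarrow>\<^sub>0 'k::field) set ring) End_ring (nekrashevych_rep G \<phi>) =
    (\<lambda>a. tight_ideal IS Zero +>\<^bsub>K0S G \<phi>\<^esub> a) ` singular_ideal IS Zero"
proof -
  let ?N = "nekrashevych_algebra G \<phi> :: (('x, 'g) iselem \<Rightarrow>\<^sub>0 'k) set ring"
  have "a_kernel ?N End_ring (nekrashevych_rep G \<phi>) = {K \<in> carrier ?N. nekrashevych_rep G \<phi> K = (\<lambda>_. 0)}"
    unfolding a_kernel_def' by (simp only: End_ring_def ring_record_simps)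
  also have "\<dots> = (+>\<^bsub>K0S G \<phi>\<^esub>) (cuntz_krieger_ideal G \<phi>) ` singular_ideal IS Zero"
    unfolding carrier_nekrashevych using nekrashevych_rep_coset singular_iff_acts_trivially by auto
  finally show ?thesis by (simp only: tight_eq_cuntz_krieger)
qed

lemma nekrashevych_rep_inj_iff:
  "inj_on (nekrashevych_rep G \<phi> :: (('x, 'g) iselem \<Rightarrow>\<^sub>0 'k::field) set \<Rightarrow> _) (carrier (nekrashevych_algebra G \<phi>)) \<longleftrightarrow>
    (singular_ideal IS Zero :: (('x, 'g) iselem \<Rightarrow>\<^sub>0 'k) set) \<subseteq> cuntz_krieger_ideal G \<phi>"
    (is "inj_on ?nrep (carrier ?N) \<longleftrightarrow> ?I \<subseteq> ?C")
proof -
  let ?R = "K0S G \<phi> :: (('x, 'g) iselem \<Rightarrow>\<^sub>0 'k) ring"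
  interpret R: ring ?R by (rule IS.ring_contracted_algebra)
  note C = cuntz_krieger_ideal_ideal[where ?'k = 'k]
  interpret C: ideal ?C ?R by (rule C)
  note carr = carrier_nekrashevych and nrep = nekrashevych_rep_coset and ker = singular_iff_acts_trivially
  have zero_C: "\<zero>\<^bsub>?R\<^esub> \<in> ?C" by (rule additive_subgroup.zero_closed[OF ideal.axioms(1)[OF C]])
  have zero_I: "\<zero>\<^bsub>?R\<^esub> \<in> ?I" using zero_C cuntz_krieger_subset_singular by blast
  show ?thesis
  proof
    assume inj: "inj_on ?nrep (carrier ?N)"
    show "?I \<subseteq> ?C"
    proof
      fix a assume a: "a \<in> ?I"
      have "?nrep (?C +>\<^bsub>?R\<^esub> a) = ?nrep (?C +>\<^bsub>?R\<^esub> \<zero>\<^bsub>?R\<^esub>)"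
        using a zero_I nrep[of a] nrep[of "\<zero>\<^bsub>?R\<^esub>"] unfolding ker by simp
      then have "?C +>\<^bsub>?R\<^esub> a = ?C +>\<^bsub>?R\<^esub> \<zero>\<^bsub>?R\<^esub>"
        using a ker carr by (intro inj_onD[OF inj]) auto
      then have "?C +>\<^bsub>?R\<^esub> a = ?C" using R.a_rcos_zero[OF C zero_C] by simp
      then show "a \<in> ?C" using a ker C.rcos_const_imp_mem by blast
    qed
  next
    assume IC: "?I \<subseteq> ?C"
    show "inj_on ?nrep (carrier ?N)"
    proof (rule inj_onI)
      fix K L assume "K \<in> carrier ?N" "L \<in> carrier ?N" and eq: "?nrep K = ?nrep L"
      then obtain a b where ab: "a \<in> carrier ?R" "b \<in> carrier ?R" "K = ?C +>\<^bsub>?R\<^esub> a" "L = ?C +>\<^bsub>?R\<^esub> b"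
        unfolding carr by blast
      then have "stream_rep G \<phi> a = stream_rep G \<phi> b"
        using eq nrep[OF ab(1)] nrep[OF ab(2)] by simp
      then have "stream_rep G \<phi> (a - b) = (\<lambda>_. 0)"
        using rep_add_left[of "a - b" b] by (simp add: fun_eq_iff)
      then have "a - b \<in> ?C" using IC ab K0S_diff ker by blast
      then have "a \<ominus>\<^bsub>?R\<^esub> b \<in> ?C" by (simp only: IS.minus_contracted_algebra[OF ab(1,2)])
      then show "K = L" using R.quotient_eq_iff_same_a_r_cos[OF C ab(1,2)] ab by simp
    qed
  qed
qed

lemma nekrashevych_simple_iff:
  "simple_algebra (nekrashevych_algebra G \<phi> :: (('x, 'g) iselem \<Rightarrow>\<^sub>0 'k::field) set ring) \<longleftrightarrow>
    (singular_ideal IS Zero :: (('x, 'g) iselem \<Rightarrow>\<^sub>0 'k) set) \<subseteq> cuntz_krieger_ideal G \<phi>"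
  unfolding nekrashevych_algebra_def
proof (rule ring.simple_quotient_iff[OF IS.ring_contracted_algebra cuntz_krieger_ideal_ideal
      singular_ideal_ideal cuntz_krieger_subset_singular _ ideal_not_singular_eq_carrier])
  show "\<one>\<^bsub>K0S G \<phi>\<^esub> \<notin> (singular_ideal IS Zero :: (('x, 'g) iselem \<Rightarrow>\<^sub>0 'k) set)"
    unfolding singular_iff_acts_trivially using rep_one_nonzero by blast
qed

end

theorem theorem5p3:
  fixes G :: "('g, 'm) monoid_scheme"
    and \<phi> :: "'g \<Rightarrow> 'x::finite list \<Rightarrow> 'x list"
  assumes "self_similar_group G \<phi>"
  shows "a_kernel (K0S G \<phi> :: (('x, 'g) iselem \<Rightarrow>\<^sub>0 'k::field) ring) End_ring (stream_rep G \<phi>)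
      = singular_ideal (inv_semigroup G \<phi>) Zero
    \<and> a_kernel (nekrashevych_algebra G \<phi> :: (('x, 'g) iselem \<Rightarrow>\<^sub>0 'k) set ring)
        End_ring (nekrashevych_rep G \<phi>)
      = (\<lambda>a. tight_ideal (inv_semigroup G \<phi>) Zero +>\<^bsub>K0S G \<phi>\<^esub> a)
        ` singular_ideal (inv_semigroup G \<phi>) Zero
    \<and> (simple_algebra (nekrashevych_algebra G \<phi> :: (('x, 'g) iselem \<Rightarrow>\<^sub>0 'k) set ring)
      \<longleftrightarrow> inj_on (nekrashevych_rep G \<phi> :: (('x, 'g) iselem \<Rightarrow>\<^sub>0 'k) set \<Rightarrow> _)
            (carrier (nekrashevych_algebra G \<phi>)))"
proof -
  interpret self_similar_group G \<phi> by fact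
  show ?thesis
    using kernel_eq_singular nekrashevych_kernel nekrashevych_simple_iff nekrashevych_rep_inj_iff by blast
qed

end
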